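(* Let $\beta=\frac{1+\sqrt5}2$ and $0<p<1$. For $\nu_{\beta,p}$-a.e. $(\omega,x)\in\Omega\times[0,\beta]$ for which $\lim_{k\to\infty}\frac{M_k(\omega,x)}k$ exists, one has $$d\big(\nu_{\beta,p},(\omega,x)\big)=\frac{H(p)}{\log\beta}\Big(2-\lim_{k\to\infty}\frac{M_k(\omega,x)}k\Big),$$ where $H(p)=-p\log p-(1-p)\log(1-p)$ and the local dimension is taken with respect to the metric $\rho$.
   Context: Let $\beta=\frac{1+\sqrt5}2$, $\Omega=\{0,1\}^{\mathbb N}$ with left shift $\sigma$, and partition $[0,\beta]$ into $E_0=[0,\frac1\beta)$, $S=[\frac1\beta,1]$, $E_1=(1,\beta]$. Let $T_0x=\beta x$, $T_1x=\beta x-1$. The random $\beta$-transformation $K:\Omega\times[0,\beta]\to\Omega\times[0,\beta]$ is $K(\omega,x)=(\omega,T_0x)$ if $x\in E_0$, $K(\omega,x)=(\omega,T_1x)$ if $x\in E_1$, and $K(\omega,x)=(\sigma\omega,T_{\omega_1}x)$ if $x\in S$. Digits: $b_1(\omega,x)=0$ if $x\in E_0$ or ($x\in S$ and $\omega_1=0$); $b_1(\omega,x)=1$ if $x\in E_1$ or ($x\in S$ and $\omega_1=1$); $b_n(\omega,x)=b_1(K^{n-1}(\omega,x))$; $\phi(\omega,x)=(b_n(\omega,x))_{n\ge1}\in\{0,1\}^{\mathbb N}$. Let $Z$ be the set of $(\omega,x)$ for which $K^n(\omega,x)\in\Omega\times S$ for infinitely many $n$; $\phi$ is a bimeasurable bijection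 from $Z$ onto its image. Let $m_p$ be the product measure on $\{0,1\}^{\mathbb N}$ with $m_p([0])=p$, $m_p([1])=1-p$, and $\nu_{\beta,p}=m_p\circ\phi$, i.e. $\nu_{\beta,p}(A)=m_p(\phi(A\cap Z))$, a $K$-invariant ergodic probability measure. Coding: $\alpha_j(\omega,x)=e_0,s,e_1$ according as $K^{j-1}(\omega,x)$ lies in $\Omega\times E_0$, $\Omega\times S$, $\Omega\times E_1$. Metric: for distinct points, $$\rho\big((\omega,x),(\omega',x')\big)=\beta^{-\min\{k\ge0:\ \omega_{k+1}\ne\omega'_{k+1}\text{ or }\alpha_{k+1}(\omega,x)\ne\alpha_{k+1}(\omega',x')\}}$$ (and $0$ for equal points). $M_k(\omega,x)=\sum_{i=0}^{k-1}\mathbf 1_{\Omega\times S}(K^i(\omega,x))$. For a probability measure $\mu$ on a metric space, $d(\mu,z)=\lim_{r\downarrow0}\frac{\log\mu(B(z,r))}{\log r}$ when the limit exists, with $B(z,r)$ the open ball. *)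

theory Defs
  imports "HOL-Probability.Probability"
begin

text \<open>
  Points of \<open>\<Omega> = {0,1}^N\<close> are functions \<open>nat \<Rightarrow> bool\<close>, where \<open>False\<close> is 0 and \<open>True\<close> is 1.  All
  sequences are indexed from 0: \<open>\<omega> 0\<close> is \<open>\<omega>\<^sub>1\<close>, and likewise \<open>digit j\<close> is \<open>b\<^sub>j\<^sub>+\<^sub>1\<close> and
  \<open>coding j\<close> is \<open>\<alpha>\<^sub>j\<^sub>+\<^sub>1\<close>.
\<close>

type_synonym point = "(nat \<Rightarrow> bool) \<times> real"

definition \<beta> :: real where
  "\<beta> = (1 + sqrt 5) / 2"

definition E\<^sub>0 :: "real set" where "E\<^sub>0 = {0..<1/\<beta>}"
definition S :: "real set" where "S = {1/\<beta>..1}"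
definition E\<^sub>1 :: "real set" where "E\<^sub>1 = {1<..\<beta>}"

definition X :: "point set" where
  "X = UNIV \<times> {0..\<beta>}"

definition shift :: "(nat \<Rightarrow> bool) \<Rightarrow> (nat \<Rightarrow> bool)" where
  "shift \<omega> = (\<lambda>n. \<omega> (Suc n))"

definition T :: "bool \<Rightarrow> real \<Rightarrow> real" where
  "T b x = \<beta> * x - of_bool b"

text \<open>Only the values on \<^term>\<open>X\<close> matter, where the last branch is the case \<^term>\<open>x \<in> S\<close>.\<close>

definition K :: "point \<Rightarrow> point" where
  "K = (\<lambda>(\<omega>, x). if x \<in> E\<^sub>0 then (\<omega>, T False x)
                 else if x \<in> E\<^sub>1 then (\<omega>, T True x)
                 else (shift \<omega>, T (\<omega> 0) x))"

definition digit :: "nat \<Rightarrow> point \<Rightarrow> bool" where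
  "digit j z = (case (K ^^ j) z of (\<omega>, x) \<Rightarrow> x \<in> E\<^sub>1 \<or> (x \<in> S \<and> \<omega> 0))"

definition \<phi> :: "point \<Rightarrow> (nat \<Rightarrow> bool)" where
  "\<phi> z = (\<lambda>j. digit j z)"

definition Z :: "point set" where
  "Z = {z \<in> X. \<exists>\<^sub>\<infinity>n. (K ^^ n) z \<in> UNIV \<times> S}"

text \<open>\<^term>\<open>bernoulli_pmf q\<close> gives \<^term>\<open>True\<close> (digit 1) mass \<open>q\<close>, so digit 0 has mass \<open>p\<close>.\<close>

definition m :: "real \<Rightarrow> (nat \<Rightarrow> bool) measure" where
  "m p = (\<Pi>\<^sub>M i\<in>UNIV. measure_pmf (bernoulli_pmf (1 - p)))"

definition \<nu> :: "real \<Rightarrow> point measure" where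
  "\<nu> p = measure_of X
     (sets (restrict_space ((\<Pi>\<^sub>M i\<in>UNIV. count_space UNIV) \<Otimes>\<^sub>M borel) X))
     (\<lambda>A. emeasure (m p) (\<phi> ` (A \<inter> Z)))"

datatype symbol = Sym_e0 | Sym_s | Sym_e1

definition coding :: "nat \<Rightarrow> point \<Rightarrow> symbol" where
  "coding j z = (let x = snd ((K ^^ j) z) in
     if x \<in> E\<^sub>0 then Sym_e0 else if x \<in> E\<^sub>1 then Sym_e1 else Sym_s)"

definition \<rho> :: "point \<Rightarrow> point \<Rightarrow> real" where
  "\<rho> z z' = (if z = z' then 0
     else (1/\<beta>) ^ (LEAST k. fst z k \<noteq> fst z' k \<or> coding k z \<noteq> coding k z'))"

definition M :: "nat \<Rightarrow> point \<Rightarrow> real" where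
  "M k z = (\<Sum>i<k. indicator (UNIV \<times> S) ((K ^^ i) z))"

definition H :: "real \<Rightarrow> real" where
  "H p = - p * ln p - (1 - p) * ln (1 - p)"

text \<open>
  \<open>has_local_dim A d \<mu> z D\<close>: the local dimension of \<open>\<mu>\<close> at \<open>z\<close>, in the metric space \<open>(A, d)\<close>, exists
  and is the finite number \<open>D\<close>.  The first conjunct excludes the convention \<^term>\<open>ln (0::real) = 0\<close>: a
  point outside the support of \<open>\<mu>\<close> has no finite local dimension.
\<close>

definition has_local_dim ::
    "'a set \<Rightarrow> ('a \<Rightarrow> 'a \<Rightarrow> real) \<Rightarrow> 'a measure \<Rightarrow> 'a \<Rightarrow> real \<Rightarrow> bool" where
  "has_local_dim A d \<mu> z D \<longleftrightarrow>
     (\<forall>\<^sub>F r in at_right 0. measure \<mu> (Metric_space.mball A d z r) > 0) \<and>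
     ((\<lambda>r. ln (measure \<mu> (Metric_space.mball A d z r)) / ln r) \<longlongrightarrow> D) (at_right 0)"

text \<open>
  The coding separates points, so the minimum in the definition of \<^term>\<open>\<rho>\<close> exists and \<^term>\<open>\<rho>\<close> is a
  metric on \<^term>\<open>X\<close>.
\<close>

lemma \<beta>_gt_1: "\<beta> > 1"
  unfolding \<beta>_def by (simp add: real_less_rsqrt)

lemma \<beta>_square: "\<beta> * \<beta> = \<beta> + 1"
  unfolding \<beta>_def by (simp add: field_simps)

lemma K_in_X:
  assumes "z \<in> X" shows "K z \<in> X"
proof -
  obtain \<omega> x where z: "z = (\<omega>, x)" by force
  have x: "0 \<le> x" "x \<le> \<beta>" using assms by (auto simp: z X_def)
  have up: "\<beta> * x \<le> \<beta> + 1"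
    using mult_left_mono[OF x(2), of \<beta>] \<beta>_gt_1 \<beta>_square by simp
  have low: "0 \<le> \<beta> * x" using x \<beta>_gt_1 by simp
  have "1 \<le> \<beta> * x" if "x \<notin> E\<^sub>0"
    using that x \<beta>_gt_1 by (auto simp: E\<^sub>0_def field_simps)
  moreover have "\<beta> * x \<le> \<beta>" if "x \<notin> E\<^sub>1"
    using that x \<beta>_gt_1 by (auto simp: E\<^sub>1_def)
  moreover have "\<beta> * x < 1" if "x \<in> E\<^sub>0"
    using that \<beta>_gt_1 by (auto simp: E\<^sub>0_def field_simps)
  moreover obtain y where y: "\<beta> * x = y" by blast
  moreover have "snd (K z) = (if x \<in> E\<^sub>0 then y else if x \<in> E\<^sub>1 then y - 1 else y - of_bool (\<omega> 0))"
    by (simp add: z K_def T_def y)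
  ultimately show ?thesis
    using up low \<beta>_gt_1 unfolding y by (auto simp: X_def mem_Times_iff)
qed

lemma coding_separates:
  assumes X: "z \<in> X" "z' \<in> X"
    and eq: "fst z = fst z'" "\<And>k. coding k z = coding k z'"
  shows "z = z'"
proof -
  have iter: "fst ((K ^^ n) z) = fst ((K ^^ n) z') \<and>
      snd ((K ^^ n) z) - snd ((K ^^ n) z') = \<beta> ^ n * (snd z - snd z')" for n
  proof (induction n)
    case 0
    show ?case using eq(1) by simp
  next
    case (Suc n)
    obtain w x y where p: "(K ^^ n) z = (w, x)" "(K ^^ n) z' = (w, y)"
      using Suc by (metis prod.collapse)
    have d: "x - y = \<beta> ^ n * (snd z - snd z')" using Suc p by simp
    have "\<beta> * x - \<beta> * y = \<beta> * \<beta> ^ n * (snd z - snd z')"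
      using d by (metis mult.assoc right_diff_distrib)
    moreover have c: "x \<in> E\<^sub>0 \<longleftrightarrow> y \<in> E\<^sub>0" "x \<notin> E\<^sub>0 \<Longrightarrow> x \<in> E\<^sub>1 \<longleftrightarrow> y \<in> E\<^sub>1"
      using eq(2)[of n] by (auto simp: coding_def p Let_def split: if_splits)
    moreover have "snd (K (w, x)) - snd (K (w, y)) = \<beta> * x - \<beta> * y"
        "fst (K (w, x)) = fst (K (w, y))"
      using c by (auto simp: K_def T_def)
    ultimately show ?case by (simp add: p)
  qed
  have inX: "(K ^^ n) z \<in> X" if "z \<in> X" for n z
    using that by (induction n) (auto intro: K_in_X)
  have bound: "\<beta> ^ n * \<bar>snd z - snd z'\<bar> \<le> \<beta>" for n
  proof -
    have "\<beta> ^ n * \<bar>snd z - snd z'\<bar> = \<bar>snd ((K ^^ n) z) - snd ((K ^^ n) z')\<bar>"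
      using iter[of n] \<beta>_gt_1 by (simp add: abs_mult)
    also have "\<dots> \<le> \<beta>"
      using inX[OF X(1), of n] inX[OF X(2), of n] by (auto simp: X_def)
    finally show ?thesis .
  qed
  have "snd z = snd z'"
  proof (rule ccontr)
    assume "snd z \<noteq> snd z'"
    then have pos: "\<bar>snd z - snd z'\<bar> > 0" by simp
    obtain n where "\<beta> / \<bar>snd z - snd z'\<bar> < \<beta> ^ n"
      using real_arch_pow[OF \<beta>_gt_1] by blast
    with bound[of n] pos show False by (simp add: field_simps)
  qed
  with eq(1) show ?thesis by (simp add: prod_eq_iff)
qed

lemma Metric_space_\<rho>: "Metric_space X \<rho>"
proof
  show "0 \<le> \<rho> z z'" for z z' using \<beta>_gt_1 by (simp add: \<rho>_def)
  show "\<rho> z z' = \<rho> z' z" for z z'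
    unfolding \<rho>_def by (simp add: eq_commute[of "fst z _"] eq_commute[of "coding _ z"] eq_commute[of z])
  show "\<rho> z z' = 0 \<longleftrightarrow> z = z'" for z z' using \<beta>_gt_1 by (simp add: \<rho>_def)
  show "\<rho> z z'' \<le> \<rho> z z' + \<rho> z' z''" if X: "z \<in> X" "z' \<in> X" "z'' \<in> X" for z z' z''
  proof (cases "z = z' \<or> z' = z'' \<or> z = z''")
    case True
    then show ?thesis using \<beta>_gt_1 by (auto simp: \<rho>_def)
  next
    case False
    define P where "P = (\<lambda>u v k. fst u k \<noteq> fst v k \<or> coding k u \<noteq> coding k v)"
    have \<rho>: "\<rho> u v = (1/\<beta>) ^ (LEAST k. P u v k)" if "u \<noteq> v" for u v
      using that by (simp add: \<rho>_def P_def)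
    have mono: "(1/\<beta>) ^ b \<le> (1/\<beta>) ^ a" if "a \<le> b" for a b
      using that \<beta>_gt_1 by (intro power_decreasing) auto
    have pos: "0 \<le> (1/\<beta>) ^ a" for a using \<beta>_gt_1 by simp
    have "\<exists>k. P z z'' k"
      using coding_separates[OF X(1,3)] False by (auto simp: P_def fun_eq_iff)
    then have "P z z'' (LEAST k. P z z'' k)" by (rule LeastI_ex)
    then have "P z z' (LEAST k. P z z'' k) \<or> P z' z'' (LEAST k. P z z'' k)"
      by (auto simp: P_def)
    then have "(LEAST k. P z z' k) \<le> (LEAST k. P z z'' k) \<or>
        (LEAST k. P z' z'' k) \<le> (LEAST k. P z z'' k)"
      by (auto intro: Least_le)
    then show ?thesis
      using False mono pos by (smt (verit) \<rho>)
  qed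
qed

end

theory Submission
  imports Defs
begin

text \<open>
  Let \<open>b\<close> be the digit sequence of a point, with values \<open>x\<^sub>n = \<Sum>\<^sub>i b\<^sub>n\<^sub>+\<^sub>i \<beta>\<^sup>-\<^sup>i\<close>.  For the golden mean the partition is
  Markov: away from orbits that meet its boundary, the region of \<open>x\<^sub>n\<close> is determined by \<open>b\<^sub>n\<close> and the
  region of \<open>x\<^sub>n\<^sub>+\<^sub>1\<close>.  Comparing the cases of the first digit gives linear equations for the
  \<open>m\<^sub>p\<close>-probability that \<open>x\<^sub>0\<close> lies in a given region while the digits used on \<open>S\<close>, which form the
  coordinate \<open>\<omega>\<close>, start with a given word.  They show that \<open>\<omega>\<close> is independent of the region of \<open>x\<^sub>0\<close>
  and distributed according to \<open>m\<^sub>1\<^sub>-\<^sub>p\<close>.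

  A ball of radius about \<open>\<beta>\<^sup>-\<^sup>k\<close> fixes the first \<open>k\<close> symbols of the coding and of \<open>\<omega>\<close>.  That amounts to
  fixing the first \<open>k\<close> digits and the \<open>k - M\<^sub>k\<close> digits used at the next visits to \<open>S\<close>, so by the law of large
  numbers its measure is \<open>exp (- H(p) (2k - M\<^sub>k) + o(k))\<close>.
\<close>

subsection \<open>Digit sequences as points\<close>

abbreviation seqs :: "(nat \<Rightarrow> bool) measure" where
  "seqs \<equiv> Pi\<^sub>M UNIV (\<lambda>_. count_space UNIV)"

definition val :: "(nat \<Rightarrow> bool) \<Rightarrow> real" where
  "val b = (\<Sum>i. of_bool (b i) / \<beta> ^ Suc i)"

definition region :: "real \<Rightarrow> symbol" where
  "region x = (if x \<in> E\<^sub>0 then Sym_e0 else if x \<in> E\<^sub>1 then Sym_e1 else Sym_s)"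

lemma coding_eq: "coding j z = region (snd ((K ^^ j) z))"
  by (simp add: coding_def region_def Let_def)

lemma \<beta>_pos [simp]: "0 < \<beta>" "\<beta> \<noteq> 0" "0 \<le> \<beta>" "1 < \<beta>" "1 \<le> \<beta>" "\<beta> \<noteq> 1"
  using \<beta>_gt_1 by auto

lemma \<beta>_inverse: "1 / \<beta> = \<beta> - 1"
  using \<beta>_square by (simp add: field_simps)

lemma less_inverse_\<beta>_imp: "x < 1 / \<beta> \<Longrightarrow> x < 1"
  by (erule less_trans) simp

lemma region_e0_iff: "0 \<le> x \<Longrightarrow> region x = Sym_e0 \<longleftrightarrow> x < 1 / \<beta>"
  by (auto dest: less_inverse_\<beta>_imp simp: region_def E\<^sub>0_def E\<^sub>1_def)

lemma region_e1_iff: "x \<le> \<beta> \<Longrightarrow> region x = Sym_e1 \<longleftrightarrow> 1 < x"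
  by (auto dest: less_inverse_\<beta>_imp simp: region_def E\<^sub>0_def E\<^sub>1_def)

lemma region_s_iff: "0 \<le> x \<Longrightarrow> x \<le> \<beta> \<Longrightarrow> region x = Sym_s \<longleftrightarrow> x \<in> S"
  by (auto dest: less_inverse_\<beta>_imp simp: region_def E\<^sub>0_def E\<^sub>1_def S_def)

lemma INFM_Suc_iff: "(\<exists>\<^sub>\<infinity>n. P (Suc n)) \<longleftrightarrow> (\<exists>\<^sub>\<infinity>n. P n)"
  unfolding frequently_def cofinite_eq_sequentially
  using eventually_sequentially_Suc[of "\<lambda>n. \<not> P n"] by simp

lemma shift_apply: "shift b n = b (Suc n)"
  by (simp add: shift_def)

lemma shift_case_nat [simp]: "shift (case_nat c b) = b"
  by (rule ext) (simp add: shift_def)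

lemma shift_funpow_apply: "(shift ^^ n) b i = b (n + i)"
  by (induction n arbitrary: i) (simp_all add: shift_apply)

text \<open>The geometric series sums to 1/(\<beta> - 1), which equals \<beta> because 1/\<beta> =
  \<beta> - 1. So every 0-1 sequence has its value in [0, \<beta>].\<close>

lemma val_sums: "(\<lambda>i. 1 / \<beta> ^ Suc i) sums \<beta>"
proof -
  have "(\<lambda>i. (1 / \<beta>) * (1 / \<beta>) ^ i) sums ((1 / \<beta>) * (1 / (1 - 1 / \<beta>)))"
    by (intro sums_mult geometric_sums) simp
  moreover have "(1 / \<beta>) * (1 / (1 - 1 / \<beta>)) = 1 / (\<beta> - 1)"
    by (simp add: divide_simps)
  moreover have "1 / (\<beta> - 1) = \<beta>"
    unfolding \<beta>_inverse[symmetric] by simp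
  ultimately show ?thesis
    by (simp add: power_divide)
qed

lemma val_summable: "summable (\<lambda>i. of_bool (b i) / \<beta> ^ Suc i :: real)"
  by (rule summable_comparison_test'[OF sums_summable[OF val_sums], of 0]) (auto split: split_of_bool)

lemma val_nonneg [simp]: "0 \<le> val b"
  unfolding val_def by (intro suminf_nonneg val_summable) simp

lemma val_le [simp]: "val b \<le> \<beta>"
proof -
  have "val b \<le> (\<Sum>i. 1 / \<beta> ^ Suc i)"
    unfolding val_def by (intro suminf_le val_summable sums_summable[OF val_sums]) (auto simp: divide_simps)
  also have "\<dots> = \<beta>"
    using val_sums by (rule sums_unique[symmetric])
  finally show ?thesis .
qed

lemma val_rec: "val b = (of_bool (b 0) + val (shift b)) / \<beta>"
proof -
  have "val b = (\<Sum>i. of_bool (b (Suc i)) / \<beta> ^ Suc (Suc i)) + of_bool (b 0) / \<beta>"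
    unfolding val_def using suminf_split_head[OF val_summable[of b]] by (simp add: shift_apply)
  also have "(\<Sum>i. of_bool (b (Suc i)) / \<beta> ^ Suc (Suc i)) = (\<Sum>i. of_bool (shift b i) / \<beta> ^ Suc i / \<beta>)"
    by (simp add: shift_apply field_simps)
  also have "\<dots> = val (shift b) / \<beta>"
    unfolding val_def by (rule suminf_divide[OF val_summable])
  finally show ?thesis by (simp add: add_divide_distrib)
qed

lemma val_shift: "val (shift b) = \<beta> * val b - of_bool (b 0)"
  using val_rec[of b] by (simp add: field_simps)

lemma val_case_nat: "val (case_nat c b) = (of_bool c + val b) / \<beta>"
  by (subst val_rec) simp

text \<open>The sequences that encode the points of \<^const>\<open>Z\<close>.\<close>

definition visits :: "(nat \<Rightarrow> bool) set" where
  "visits = {b. \<exists>\<^sub>\<infinity>n. val ((shift ^^ n) b) \<in> S}"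

text \<open>\<open>LEAST\<close> is unspecified when the orbit never meets \<open>S\<close>, so
  \<open>hit_Suc\<close> and \<open>sel_notin_S\<close> assume
  \<open>b \<in> visits\<close>.\<close>

definition hit :: "(nat \<Rightarrow> bool) \<Rightarrow> nat" where
  "hit b = (LEAST n. val ((shift ^^ n) b) \<in> S)"

text \<open>The digit used at visit number n to \<open>S\<close>, counted from 0. Since
  \<open>K\<close> reads and drops one coordinate of \<omega> per visit, this recovers
  \<omega>.\<close>

primrec sel :: "nat \<Rightarrow> (nat \<Rightarrow> bool) \<Rightarrow> bool" where
  "sel 0 b = b (hit b)"
| "sel (Suc n) b = sel n ((shift ^^ Suc (hit b)) b)"

text \<open>The inverse of \<open>\<phi>\<close> between \<open>visits\<close> and \<open>Z\<close>;
  see \<open>\<phi>_point_of\<close> and \<open>point_of_\<phi>\<close>.\<close>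

definition point_of :: "(nat \<Rightarrow> bool) \<Rightarrow> point" where
  "point_of b = (\<lambda>n. sel n b, val b)"

lemma visits_shift_iff: "shift b \<in> visits \<longleftrightarrow> b \<in> visits"
proof -
  have "(\<exists>\<^sub>\<infinity>n. val ((shift ^^ Suc n) b) \<in> S) \<longleftrightarrow> (\<exists>\<^sub>\<infinity>n. val ((shift ^^ n) b) \<in> S)"
    using INFM_Suc_iff[of "\<lambda>n. val ((shift ^^ n) b) \<in> S"] by auto
  then show ?thesis
    by (simp add: visits_def funpow_swap1)
qed

lemma hit_0: "val b \<in> S \<Longrightarrow> hit b = 0"
  unfolding hit_def by (rule Least_eq_0) simp

lemma hit_Suc:
  assumes "b \<in> visits" "val b \<notin> S"
  shows "hit b = Suc (hit (shift b))"
proof -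
  obtain n where "val ((shift ^^ n) b) \<in> S"
    using assms(1) by (auto simp: visits_def dest: INFM_EX)
  then have "hit b = Suc (LEAST n. val ((shift ^^ Suc n) b) \<in> S)"
    unfolding hit_def by (rule Least_Suc) (use assms in simp)
  then show ?thesis by (simp add: hit_def funpow_swap1)
qed

lemma sel_in_S:
  assumes "val b \<in> S"
  shows "sel 0 b = b 0" "sel (Suc n) b = sel n (shift b)"
  using hit_0[OF assms] by simp_all

lemma sel_notin_S:
  assumes "b \<in> visits" "val b \<notin> S"
  shows "sel n b = sel n (shift b)"
  using hit_Suc[OF assms] by (cases n) (simp_all add: funpow_swap1 shift_apply)

lemma point_of_in_X [simp]: "point_of b \<in> X"
  by (simp add: point_of_def X_def)

text \<open>The tail value \<beta> x - b 0 has to stay in [0, \<beta>]. On \<open>E\<^sub>0\<close>,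
  \<beta> x < 1 rules out the digit 1; on \<open>E\<^sub>1\<close>, \<beta> x > \<beta> rules out
  the digit 0.\<close>

lemma digit_0:
  shows "val b \<in> E\<^sub>0 \<Longrightarrow> \<not> b 0" and "val b \<in> E\<^sub>1 \<Longrightarrow> b 0"
proof -
  have "val (shift b) < 1 - of_bool (b 0)" if "val b \<in> E\<^sub>0"
    using that by (auto simp: E\<^sub>0_def val_shift field_simps)
  then show "val b \<in> E\<^sub>0 \<Longrightarrow> \<not> b 0"
    using val_nonneg[of "shift b"] by (cases "b 0") (auto simp del: val_nonneg)
  have "val (shift b) > \<beta> - of_bool (b 0)" if "val b \<in> E\<^sub>1"
    using that by (auto simp: E\<^sub>1_def val_shift)
  then show "val b \<in> E\<^sub>1 \<Longrightarrow> b 0"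
    using val_le[of "shift b"] by (cases "b 0") (auto simp del: val_le)
qed

lemma not_S: "0 \<le> x \<Longrightarrow> x \<le> \<beta> \<Longrightarrow> x \<notin> S \<longleftrightarrow> x \<in> E\<^sub>0 \<or> x \<in> E\<^sub>1"
  by (auto dest: less_inverse_\<beta>_imp simp: E\<^sub>0_def E\<^sub>1_def S_def)

lemma disjoint_regions: "x \<in> E\<^sub>0 \<Longrightarrow> x \<notin> E\<^sub>1" "x \<in> S \<Longrightarrow> x \<notin> E\<^sub>0" "x \<in> S \<Longrightarrow> x \<notin> E\<^sub>1"
  by (auto dest: less_inverse_\<beta>_imp simp: E\<^sub>0_def E\<^sub>1_def S_def)

text \<open>On \<open>S\<close> the branch is chosen by \<open>sel 0 b\<close>, which is
  \<open>b 0\<close>, and one choice is dropped. Off \<open>S\<close> the branch of \<open>K\<close>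
  is the one forced by \<open>digit_0\<close>, and the choices are kept.\<close>

lemma K_point_of:
  assumes "b \<in> visits"
  shows "K (point_of b) = point_of (shift b)"
proof (cases "val b \<in> S")
  case True
  then show ?thesis
    using disjoint_regions[of "val b"] sel_in_S[OF True]
    by (simp add: point_of_def K_def T_def val_shift shift_def[of "\<lambda>n. sel n b"] del: sel.simps)
next
  case False
  then consider "val b \<in> E\<^sub>0" "val b \<notin> E\<^sub>1" | "val b \<in> E\<^sub>1" "val b \<notin> E\<^sub>0"
    using not_S[of "val b"] disjoint_regions by auto
  then show ?thesis
    using sel_notin_S[OF assms False] digit_0[of b]
    by cases (simp_all add: point_of_def K_def T_def val_shift)
qed

lemma visits_funpow_iff: "(shift ^^ n) b \<in> visits \<longleftrightarrow> b \<in> visits"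
  by (induction n) (simp_all add: visits_shift_iff)

lemma K_funpow_point_of:
  "b \<in> visits \<Longrightarrow> (K ^^ n) (point_of b) = point_of ((shift ^^ n) b)"
  by (induction n) (simp_all add: K_point_of visits_funpow_iff)

lemma digit_0_point_of: "b \<in> visits \<Longrightarrow> digit 0 (point_of b) = b 0"
  using digit_0[of b] not_S[of "val b"] disjoint_regions[of "val b"] sel_in_S[of b]
  by (auto simp: digit_def point_of_def simp del: sel.simps)

lemma digit_add: "digit (n + j) z = digit j ((K ^^ n) z)"
  by (simp add: digit_def add.commute[of n] funpow_add)

lemma \<phi>_point_of:
  assumes "b \<in> visits"
  shows "\<phi> (point_of b) = b"
proof
  fix n
  have "digit (n + 0) (point_of b) = (shift ^^ n) b 0"
    unfolding digit_add K_funpow_point_of[OF assms]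
    by (rule digit_0_point_of) (simp add: visits_funpow_iff assms)
  then show "\<phi> (point_of b) n = b n" by (simp add: \<phi>_def shift_funpow_apply)
qed

lemma point_of_in_Z: "b \<in> visits \<Longrightarrow> point_of b \<in> Z"
  by (simp add: Z_def K_funpow_point_of) (simp add: visits_def point_of_def)

section \<open>From points back to digit sequences\<close>

lemma K_funpow_in_X: "z \<in> X \<Longrightarrow> (K ^^ n) z \<in> X"
  by (induction n) (auto intro: K_in_X)

lemma \<phi>_K: "\<phi> (K z) = shift (\<phi> z)"
  using digit_add[of 1 _ z] by (auto simp: \<phi>_def shift_def)

lemma \<phi>_K_funpow: "\<phi> ((K ^^ n) z) = (shift ^^ n) (\<phi> z)"
  by (induction n) (simp_all add: \<phi>_K)

lemma snd_K:
  assumes "z \<in> X"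
  shows "snd (K z) = \<beta> * snd z - of_bool (digit 0 z)"
  using assms not_S[of "snd z"] disjoint_regions[of "snd z"]
  by (cases z) (auto simp: K_def T_def digit_def X_def)

text \<open>Both orbits follow the same digits, so each step multiplies their difference by \<beta>.
  As both stay in [0, \<beta>], the difference is 0.\<close>

lemma val_\<phi>:
  assumes "z \<in> X"
  shows "val (\<phi> z) = snd z"
proof (rule ccontr)
  assume ne: "val (\<phi> z) \<noteq> snd z"
  have *: "snd ((K ^^ n) z) - val ((shift ^^ n) (\<phi> z)) = \<beta> ^ n * (snd z - val (\<phi> z))" for n
  proof (induction n)
    case (Suc n)
    have "(shift ^^ n) (\<phi> z) 0 = digit 0 ((K ^^ n) z)"
      using digit_add[of n 0 z] by (simp add: \<phi>_def shift_funpow_apply)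
    then show ?case
      using Suc snd_K[OF K_funpow_in_X[OF assms], of n]
      by (simp add: val_shift right_diff_distrib[symmetric] mult.assoc)
  qed simp
  have "\<beta> ^ n * \<bar>snd z - val (\<phi> z)\<bar> \<le> \<beta>" for n
  proof -
    have "\<beta> ^ n * \<bar>snd z - val (\<phi> z)\<bar> = \<bar>snd ((K ^^ n) z) - val ((shift ^^ n) (\<phi> z))\<bar>"
      unfolding * by (simp add: abs_mult)
    also have "\<dots> \<le> \<beta>"
      using K_funpow_in_X[OF assms, of n] val_nonneg[of "(shift ^^ n) (\<phi> z)"]
        val_le[of "(shift ^^ n) (\<phi> z)"]
      by (cases "(K ^^ n) z") (simp add: X_def abs_le_iff del: val_nonneg val_le)
    finally show ?thesis .
  qed
  moreover obtain n where "\<beta> / \<bar>snd z - val (\<phi> z)\<bar> < \<beta> ^ n"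
    using real_arch_pow[OF \<beta>_gt_1] by blast
  ultimately show False using ne by (simp add: field_simps not_le[symmetric])
qed

lemma \<phi>_in_visits:
  assumes "z \<in> Z"
  shows "\<phi> z \<in> visits"
  using assms
  by (auto simp: Z_def visits_def \<phi>_K_funpow[symmetric] val_\<phi> K_funpow_in_X mem_Times_iff elim!: INFM_mono)

lemma K_in_Z: "z \<in> Z \<Longrightarrow> K z \<in> Z"
  using INFM_Suc_iff[of "\<lambda>n. (K ^^ n) z \<in> UNIV \<times> S"]
  by (auto simp: Z_def funpow_swap1 K_in_X)

text \<open>Double induction. A step of \<open>K\<close> outside \<open>S\<close> keeps the index n
  and lowers \<open>hit\<close> by one; a step in \<open>S\<close> lowers n, or reads the coordinate
  off directly if n is 0.\<close>

lemma sel_\<phi>: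
  assumes "z \<in> Z"
  shows "sel n (\<phi> z) = fst z n"
  using assms
proof (induction n arbitrary: z rule: less_induct)
  case (less n)
  from less.prems show ?case
  proof (induction "hit (\<phi> z)" arbitrary: z rule: less_induct)
    case less
    have v: "\<phi> z \<in> visits" using less.prems by (rule \<phi>_in_visits)
    have X: "z \<in> X" using less.prems by (simp add: Z_def)
    have KZ: "K z \<in> Z" using less.prems by (rule K_in_Z)
    show ?case
    proof (cases "snd z \<in> S")
      case True
      then have "fst (K z) = shift (fst z)" "\<phi> z 0 = fst z 0"
        using disjoint_regions[of "snd z"] by (cases z; simp add: K_def \<phi>_def digit_def)+
      then show ?thesis
        using True KZ sel_in_S[of "\<phi> z"] \<open>\<And>y z. y < n \<Longrightarrow> z \<in> Z \<Longrightarrow> sel y (\<phi> z) = fst z y\<close>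
        by (cases n) (simp_all add: val_\<phi> X \<phi>_K[symmetric] shift_apply del: sel.simps)
    next
      case False
      then have nS: "val (\<phi> z) \<notin> S" by (simp add: val_\<phi> X)
      have "fst (K z) = fst z"
        using X False not_S[of "snd z"] by (cases z) (auto simp: K_def X_def)
      then show ?thesis
        using less.hyps[of "K z"] KZ sel_notin_S[OF v nS] hit_Suc[OF v nS] by (simp add: \<phi>_K)
    qed
  qed
qed

lemma point_of_\<phi>: "z \<in> Z \<Longrightarrow> point_of (\<phi> z) = z"
  by (cases z) (simp add: point_of_def sel_\<phi> val_\<phi> Z_def)

text \<open>Turns the images in the definition of \<open>\<nu>\<close> into preimages under the
  measurable map \<open>point_of\<close>.\<close>

lemma \<phi>_image:
  "\<phi> ` (A \<inter> Z) = visits \<inter> point_of -` A"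
proof (intro set_eqI iffI)
  fix b assume "b \<in> visits \<inter> point_of -` A"
  then show "b \<in> \<phi> ` (A \<inter> Z)"
    using \<phi>_point_of[of b] point_of_in_Z[of b] by (force simp: image_iff)
qed (auto simp: point_of_\<phi> \<phi>_in_visits)

subsection \<open>The measure as an image of the Bernoulli measure\<close>

abbreviation points :: "point measure" where
  "points \<equiv> restrict_space (seqs \<Otimes>\<^sub>M borel) X"

lemma sets_m [measurable_cong, simp]: "sets (m p) = sets seqs"
  unfolding m_def by (intro sets_PiM_cong) simp_all

lemma space_m [simp]: "space (m p) = UNIV"
  by (simp add: m_def space_PiM)

lemma prob_space_m: "prob_space (m p)"
  unfolding m_def by (intro prob_space_PiM measure_pmf.prob_space_axioms)

lemma measurable_val [measurable]: "val \<in> borel_measurable seqs"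
  unfolding val_def[abs_def] by measurable

lemma measurable_shift [measurable]: "shift \<in> measurable seqs seqs"
  unfolding shift_def[abs_def] by (rule measurable_PiM_single') (auto simp: space_PiM)

lemma measurable_shift_funpow [measurable]: "shift ^^ n \<in> measurable seqs seqs"
  by (induction n) (simp_all add: measurable_comp)

lemma S_borel [measurable]: "S \<in> sets borel"
  by (simp add: S_def)

lemma E\<^sub>0_borel [measurable]: "E\<^sub>0 \<in> sets borel"
  by (simp add: E\<^sub>0_def)

lemma E\<^sub>1_borel [measurable]: "E\<^sub>1 \<in> sets borel"
  by (simp add: E\<^sub>1_def)

lemma measurable_region [measurable]: "region \<in> measurable borel (count_space UNIV)"
  unfolding region_def[abs_def] by measurable

lemma measurable_hit [measurable]: "hit \<in> measurable seqs (count_space UNIV)"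
  unfolding hit_def[abs_def] by measurable

text \<open>The index depends on the sequence but takes countably many values, so each value can be
  treated separately.\<close>

lemma measurable_apply_hit: "(\<lambda>b. b (hit b)) \<in> measurable seqs (count_space UNIV)"
  by (rule measurable_compose_countable[OF _ measurable_hit]) measurable

lemma measurable_shift_hit: "(\<lambda>b. (shift ^^ Suc (hit b)) b) \<in> measurable seqs seqs"
  by (rule measurable_compose_countable[OF _ measurable_hit, of "\<lambda>i b. (shift ^^ Suc i) b"]) measurable

lemma measurable_sel [measurable]: "sel n \<in> measurable seqs (count_space UNIV)"
proof (induction n)
  case 0
  then show ?case using measurable_apply_hit by simp
next
  case (Suc n)
  then show ?case using measurable_compose[OF measurable_shift_hit Suc] by simp
qed

lemma visits_sets [measurable]: "visits \<in> sets seqs"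
proof -
  have "{b \<in> space seqs. \<exists>\<^sub>\<infinity>n. val ((shift ^^ n) b) \<in> S} \<in> sets seqs"
    unfolding INFM_nat_le by measurable
  then show ?thesis by (simp add: visits_def space_PiM)
qed

lemma X_sets [measurable]: "X \<in> sets (seqs \<Otimes>\<^sub>M borel)"
proof -
  have "UNIV \<times> {0..\<beta>} \<in> sets (seqs \<Otimes>\<^sub>M (borel :: real measure))"
    using sets.top[of seqs] by (intro pair_measureI) (simp_all add: space_PiM)
  then show ?thesis unfolding X_def .
qed

lemma space_points [simp]: "space points = X"
  by (simp add: space_restrict_space space_pair_measure space_PiM)

lemma measurable_fst_points [measurable]: "fst \<in> measurable points seqs"
  by (rule measurable_restrict_space1) measurable

lemma measurable_snd_points [measurable]: "snd \<in> borel_measurable points"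
  by (rule measurable_restrict_space1) measurable

lemma measurable_into_points:
  assumes "f \<in> measurable N (seqs \<Otimes>\<^sub>M borel)" "\<And>x. x \<in> space N \<Longrightarrow> f x \<in> X"
  shows "f \<in> measurable N points"
  using assms by (intro measurable_restrict_space2) auto

lemma measurable_point_of [measurable]: "point_of \<in> measurable seqs points"
proof (rule measurable_into_points)
  have [measurable]: "(\<lambda>b n. sel n b) \<in> measurable seqs seqs"
    by (rule measurable_PiM_single') (auto simp: space_PiM)
  show "point_of \<in> measurable seqs (seqs \<Otimes>\<^sub>M borel)"
    unfolding point_of_def[abs_def] by measurable
qed simp

lemma measurable_K [measurable]: "K \<in> measurable points points"
proof (rule measurable_into_points)
  have "K = (\<lambda>z. if snd z \<in> E\<^sub>0 then (fst z, \<beta> * snd z) else if snd z \<in> E\<^sub>1 then (fst z, \<beta> * snd z - 1)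
      else (shift (fst z), \<beta> * snd z - (if fst z 0 then 1 else 0)))"
    by (auto simp: K_def T_def fun_eq_iff)
  also have "\<dots> \<in> measurable points (seqs \<Otimes>\<^sub>M borel)"
    by measurable
  finally show "K \<in> measurable points (seqs \<Otimes>\<^sub>M borel)" .
qed (simp add: K_in_X)

lemma measurable_K_funpow [measurable]: "K ^^ n \<in> measurable points points"
  by (induction n) (simp_all add: measurable_comp)

lemma measurable_coding [measurable]: "coding n \<in> measurable points (count_space UNIV)"
  unfolding coding_eq[abs_def] by measurable

lemma measurable_digit [measurable]: "digit n \<in> measurable points (count_space UNIV)"
  unfolding digit_def[abs_def] case_prod_beta by measurable

section \<open>Conditioning on the first digit\<close>

lemma pred_case_nat:
  assumes [measurable]: "Measurable.pred seqs P"
  shows "Measurable.pred seqs (\<lambda>b. P (case_nat c b))"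
proof -
  have [measurable]: "(\<lambda>b. case_nat c b) \<in> measurable seqs seqs"
    by (rule measurable_PiM_single') (auto simp: space_PiM split: nat.split)
  show ?thesis by measurable
qed

text \<open>\<open>m p\<close> is the image of the product of one coin toss and \<open>m p\<close>
  itself under prepending a digit. All the linear equations below come from this identity.\<close>

lemma m_Collect_rec:
  assumes "0 < p" "p < 1"
    and P [measurable]: "Measurable.pred seqs P"
  shows "measure (m p) {b. P b} =
    p * measure (m p) {b. P (case_nat False b)} + (1 - p) * measure (m p) {b. P (case_nat True b)}"
proof -
  define N where "N = measure_pmf (bernoulli_pmf (1 - p))"
  interpret N: prob_space N
    unfolding N_def by (rule measure_pmf.prob_space_axioms)
  interpret sequence_space N ..
  interpret m: prob_space "m p"
    by (rule prob_space_m)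
  \<comment> \<open>Here \<open>S\<close> abbreviates the sequence space over \<open>N\<close>,
    provided by the interpretation; it is not the switch region.\<close>
  have mN: "S = m p" by (simp add: m_def N_def)
  have [measurable_cong]: "sets N = sets (count_space UNIV)"
    by (simp add: N_def)
  have sp: "space N = UNIV" by (simp add: N_def)
  have [measurable]: "(\<lambda>z. case_nat (fst z) (snd z)) \<in> measurable (N \<Otimes>\<^sub>M m p) (m p)"
    unfolding mN[symmetric] by measurable
  have Pm: "Measurable.pred (m p) P" using P by simp
  have D: "distr (N \<Otimes>\<^sub>M m p) (m p) (\<lambda>z. case_nat (fst z) (snd z)) = m p"
    using PiM_iter unfolding mN by (simp add: split_beta')
  have Q: "{z. P (case_nat (fst z) (snd z))} \<in> sets (N \<Otimes>\<^sub>M m p)"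
    using measurable_compose[OF _ Pm, of "\<lambda>z. case_nat (fst z) (snd z)" "N \<Otimes>\<^sub>M m p"]
    by (simp add: pred_def space_pair_measure sp)
  have "{b. P b} \<in> sets (m p)" using Pm by (simp add: pred_def)
  then have "emeasure (m p) {b. P b} = emeasure (N \<Otimes>\<^sub>M m p) {z. P (case_nat (fst z) (snd z))}"
    by (subst D[symmetric], subst emeasure_distr) (auto simp: space_pair_measure sp vimage_def)
  also have "\<dots> = (\<integral>\<^sup>+c. emeasure (m p) {b. P (case_nat c b)} \<partial>N)"
    by (subst m.emeasure_pair_measure_alt[OF Q]) (simp add: vimage_def)
  also have "\<dots> = ennreal (1 - p) * emeasure (m p) {b. P (case_nat True b)}
      + ennreal p * emeasure (m p) {b. P (case_nat False b)}"
    unfolding N_def using assms by (subst nn_integral_bernoulli_pmf) (auto simp: mult.commute)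
  finally show ?thesis
    using assms by (simp add: m.emeasure_eq_measure ennreal_mult[symmetric] ennreal_plus[symmetric]
      add.commute del: ennreal_plus)
qed

lemma measure_m_disj:
  assumes [measurable]: "Measurable.pred seqs P" "Measurable.pred seqs Q"
    and "\<And>b. P b \<Longrightarrow> \<not> Q b"
  shows "measure (m p) {b. P b \<or> Q b} = measure (m p) {b. P b} + measure (m p) {b. Q b}"
proof -
  interpret prob_space "m p" by (rule prob_space_m)
  have "{b. P b} \<in> sets (m p)" "{b. Q b} \<in> sets (m p)"
    using assms by (simp_all add: pred_def space_PiM)
  moreover have "{b. P b \<or> Q b} = {b. P b} \<union> {b. Q b}" by auto
  ultimately show ?thesis
    using assms(3) by (simp add: finite_measure_Union disjoint_iff)
qed

lemma AE_m_iff: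
  assumes [measurable]: "Measurable.pred seqs P"
  shows "(AE b in m p. P b) \<longleftrightarrow> measure (m p) {b. \<not> P b} = 0"
proof -
  interpret prob_space "m p" by (rule prob_space_m)
  have "{b \<in> space (m p). \<not> P b} \<in> sets (m p)" by measurable
  then show ?thesis
    by (subst AE_iff_measurable[OF _ refl]) (simp_all add: emeasure_eq_measure)
qed

text \<open>The shift preserves \<open>m p\<close>: for an event about the tail, both first digits
  leave the same event.\<close>

lemma AE_m_shift:
  assumes "0 < p" "p < 1" and [measurable]: "Measurable.pred seqs P" and "AE b in m p. P b"
  shows "AE b in m p. P (shift b)"
proof -
  have "measure (m p) {b. \<not> P (shift b)} = 0"
    using assms by (subst m_Collect_rec) (simp_all add: AE_m_iff)
  then show ?thesis by (subst AE_m_iff) measurable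
qed

lemma measure_val_eq:
  assumes "0 < p" "p < 1"
  shows "measure (m p) {b. val b = c} =
    p * measure (m p) {b. val b = \<beta> * c} + (1 - p) * measure (m p) {b. val b = \<beta> * c - 1}"
proof -
  have "(val (case_nat False b) = c) \<longleftrightarrow> val b = \<beta> * c" "(val (case_nat True b) = c) \<longleftrightarrow> val b = \<beta> * c - 1" for b
    by (auto simp: val_case_nat field_simps)
  then show ?thesis
    using assms by (subst m_Collect_rec) simp_all
qed

lemma measure_val_outside:
  assumes "c < 0 \<or> c > \<beta>"
  shows "measure (m p) {b. val b = c} = 0"
proof -
  have "val b \<noteq> c" for b
    using assms val_nonneg[of b] val_le[of b] by (auto simp del: val_nonneg val_le)
  then show ?thesis by simp
qed

text \<open>The maps x to \<beta> x and x to \<beta> x - 1 send each of the four values to one of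
  them or out of [0, \<beta>]. Thus \<open>measure_val_eq\<close> gives a closed homogeneous system
  for the four masses. The masses at 0 and \<beta> vanish, and those at 1/\<beta> and 1 are
  multiplied by p(1 - p) < 1 when the two equations are composed.\<close>

lemma measure_val_boundary:
  assumes "0 < p" "p < 1" and "c \<in> {0, 1 / \<beta>, 1, \<beta>}"
  shows "measure (m p) {b. val b = c} = 0"
proof -
  let ?f = "\<lambda>c. measure (m p) {b. val b = c}"
  note r = measure_val_eq[OF assms(1,2)]
  have "?f 0 = p * ?f 0" using r[of 0] by (simp add: measure_val_outside)
  then have f0: "?f 0 = 0" using assms by simp
  have "?f \<beta> = (1 - p) * ?f \<beta>" using r[of \<beta>] by (simp add: measure_val_outside \<beta>_square)
  then have f\<beta>: "?f \<beta> = 0" using assms by simp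
  have f1: "?f 1 = (1 - p) * ?f (1 / \<beta>)" using r[of 1] by (simp add: f\<beta> \<beta>_inverse)
  have "?f (1 / \<beta>) = p * ?f 1" using r[of "1 / \<beta>"] by (simp add: f0)
  then have "?f (1 / \<beta>) = (p * (1 - p)) * ?f (1 / \<beta>)" unfolding f1 by simp
  moreover have "p * (1 - p) < 1 * 1"
    using assms by (intro mult_strict_mono) auto
  ultimately have "?f (1 / \<beta>) = 0" by (metis mult_cancel_right1 mult_1 less_irrefl)
  with f0 f1 f\<beta> show ?thesis using assms(3) by auto
qed

text \<open>
  Away from the orbits that meet the boundary of the partition, the golden mean makes the partition
  Markov.
\<close>

definition typical :: "(nat \<Rightarrow> bool) set" where
  "typical = {b. \<forall>n. val ((shift ^^ n) b) \<notin> {0, 1 / \<beta>, 1, \<beta>}}"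

lemma typical_sets [measurable]: "typical \<in> sets seqs"
proof -
  have "{b \<in> space seqs. \<forall>n. val ((shift ^^ n) b) \<notin> {0, 1 / \<beta>, 1, \<beta>}} \<in> sets seqs"
    by measurable
  then show ?thesis by (simp add: typical_def space_PiM)
qed

lemma AE_typical:
  assumes "0 < p" "p < 1"
  shows "AE b in m p. b \<in> typical"
proof -
  have "AE b in m p. val b \<notin> {0, 1 / \<beta>, 1, \<beta>}"
    using measure_val_boundary[OF assms] by (auto simp: AE_m_iff)
  then have "AE b in m p. val ((shift ^^ n) b) \<notin> {0, 1 / \<beta>, 1, \<beta>}" for n
  proof (induction n)
    case (Suc n)
    then show ?case
      using AE_m_shift[OF assms, of "\<lambda>b. val ((shift ^^ n) b) \<notin> {0, 1 / \<beta>, 1, \<beta>}"]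
      by (simp add: funpow_swap1)
  qed simp
  then show ?thesis by (simp add: typical_def AE_all_countable)
qed

text \<open>Unless it sits at c, such an orbit would move away from c geometrically, but it is
  bounded. The lemma is applied to the fixed points 0 and \<beta> of the two branches.\<close>

lemma val_dist_growth:
  assumes "\<And>n. n \<ge> N \<Longrightarrow> \<bar>val ((shift ^^ Suc n) b) - c\<bar> = \<beta> * \<bar>val ((shift ^^ n) b) - c\<bar>"
  shows "val ((shift ^^ N) b) = c"
proof (rule ccontr)
  assume "val ((shift ^^ N) b) \<noteq> c"
  then have pos: "\<bar>val ((shift ^^ N) b) - c\<bar> > 0" by simp
  have *: "\<bar>val ((shift ^^ (N + k)) b) - c\<bar> = \<beta> ^ k * \<bar>val ((shift ^^ N) b) - c\<bar>" for k
    using assms by (induction k) (auto simp del: funpow.simps)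
  obtain k where k: "(\<beta> + \<bar>c\<bar>) / \<bar>val ((shift ^^ N) b) - c\<bar> < \<beta> ^ k"
    using real_arch_pow[OF \<beta>_gt_1] by blast
  have "\<bar>val ((shift ^^ (N + k)) b) - c\<bar> \<le> \<beta> + \<bar>c\<bar>"
    using val_nonneg[of "(shift ^^ (N + k)) b"] val_le[of "(shift ^^ (N + k)) b"]
    unfolding abs_le_iff by (auto simp del: val_nonneg val_le)
  with k pos show False unfolding * by (simp add: field_simps)
qed

text \<open>An orbit that avoids \<open>S\<close> from time N on cannot change sides: the image of
  \<open>E\<^sub>0\<close> lies below 1 and that of \<open>E\<^sub>1\<close> above 1/\<beta>. It
  then expands away from the fixed point 0 or \<beta> forever, so it equals that point, which
  \<open>typical\<close> excludes.\<close>

lemma typical_visits: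
  assumes "b \<in> typical"
  shows "b \<in> visits"
proof (rule ccontr)
  assume "b \<notin> visits"
  then obtain N where N: "\<And>n. n \<ge> N \<Longrightarrow> val ((shift ^^ n) b) \<notin> S"
    by (auto simp: visits_def frequently_def cofinite_eq_sequentially eventually_sequentially)
  define v where "v = (\<lambda>n. val ((shift ^^ n) b))"
  have v: "v (Suc n) = \<beta> * v n - of_bool ((shift ^^ n) b 0)" for n
    by (simp add: v_def val_shift)
  have rng: "0 \<le> v n" "v n \<le> \<beta>" for n by (simp_all add: v_def)
  have cases: "v n \<in> E\<^sub>0 \<or> v n \<in> E\<^sub>1" if "n \<ge> N" for n
    using N[OF that] not_S[OF rng] by (simp add: v_def)
  have stay0: "v (Suc n) = \<beta> * v n \<and> v (Suc n) \<in> E\<^sub>0" if n: "n \<ge> N" "v n \<in> E\<^sub>0" for n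
  proof -
    have "v (Suc n) = \<beta> * v n" using digit_0(1)[of "(shift ^^ n) b"] n(2) v by (simp add: v_def)
    moreover have "\<beta> * v n < 1" using n(2) by (simp add: E\<^sub>0_def field_simps)
    ultimately show ?thesis using cases[of "Suc n"] n(1) by (auto simp: E\<^sub>1_def)
  qed
  have stay1: "v (Suc n) - \<beta> = \<beta> * (v n - \<beta>) \<and> v (Suc n) \<in> E\<^sub>1" if n: "n \<ge> N" "v n \<in> E\<^sub>1" for n
  proof -
    have e: "v (Suc n) = \<beta> * v n - 1" using digit_0(2)[of "(shift ^^ n) b"] n(2) v by (simp add: v_def)
    moreover have "\<beta> * v n > \<beta>" using n(2) by (simp add: E\<^sub>1_def)
    moreover have "\<beta> * v n - 1 > 1 / \<beta>" unfolding \<beta>_inverse using calculation(2) by simp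
    ultimately show ?thesis using cases[of "Suc n"] n(1) by (auto simp: E\<^sub>0_def algebra_simps \<beta>_square)
  qed
  have growth: "v N = c" if "\<And>n. n \<ge> N \<Longrightarrow> \<bar>v (Suc n) - c\<bar> = \<beta> * \<bar>v n - c\<bar>" for c
    using val_dist_growth[of N b c] that unfolding v_def by blast
  from cases[OF order.refl] have "v N = 0 \<or> v N = \<beta>"
  proof
    assume vN: "v N \<in> E\<^sub>0"
    have "v n \<in> E\<^sub>0" if "n \<ge> N" for n
      using that by (induction n rule: dec_induct) (use vN stay0 in \<open>fast+\<close>)
    then have "v N = 0"
      using stay0 by (intro growth) (simp add: abs_mult)
    then show ?thesis by simp
  next
    assume vN: "v N \<in> E\<^sub>1"
    have "v n \<in> E\<^sub>1" if "n \<ge> N" for n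
      using that by (induction n rule: dec_induct) (use vN stay1 in \<open>fast+\<close>)
    then have "v N = \<beta>"
      using stay1 by (intro growth) (simp add: abs_mult)
    then show ?thesis by simp
  qed
  then show False using assms by (auto simp: typical_def v_def)
qed

lemma AE_visits:
  assumes "0 < p" "p < 1"
  shows "AE b in m p. b \<in> visits"
  using AE_typical[OF assms] by eventually_elim (rule typical_visits)

text \<open>By \<open>\<phi>_image\<close> the two measures differ only by the complement of
  \<open>visits\<close>, a null set.\<close>

lemma \<nu>_eq_distr:
  assumes "0 < p" "p < 1"
  shows "\<nu> p = distr (m p) points point_of"
proof -
  have [measurable]: "point_of \<in> measurable (m p) points" by simp
  have "\<nu> p = measure_of X (sets points) (emeasure (distr (m p) points point_of))"
    unfolding \<nu>_def
  \<comment> \<open>\<open>measure_of\<close> depends on its set function only through the values on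
    the sigma-algebra. Agreement there with a genuine measure also shows that the formula for
    \<open>\<nu>\<close> is countably additive.\<close>
  proof (rule measure_of_eq)
    show "sets points \<subseteq> Pow X"
      using sets.space_closed[of points] by simp
    fix A assume "A \<in> sigma_sets X (sets points)"
    then have A [measurable]: "A \<in> sets points"
      using sets.sigma_sets_eq[of points] by simp
    have "point_of -` A \<in> sets (m p)"
      using measurable_sets[OF measurable_point_of A] by (simp add: space_PiM)
    then have "emeasure (m p) (visits \<inter> point_of -` A) = emeasure (m p) (point_of -` A)"
      using AE_visits[OF assms] by (intro emeasure_eq_AE) auto
    then show "emeasure (m p) (\<phi> ` (A \<inter> Z)) = emeasure (distr (m p) points point_of) A"
      by (simp add: \<phi>_image emeasure_distr A)
  qed
  also have "\<dots> = distr (m p) points point_of"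
    using measure_of_of_measure[of "distr (m p) points point_of"] by simp
  finally show ?thesis .
qed

subsection \<open>Independence of the digits chosen on the switch region\<close>

text \<open>Prepending 0 gives y/\<beta>, which is at most 1 and lies below 1/\<beta> iff y < 1.
  Prepending 1 gives (1 + y)/\<beta>, which is at least 1/\<beta> and exceeds 1 iff y > \<beta> - 1
  = 1/\<beta>. So the cut points for y are again the boundaries of the partition; at y = 1 with
  digit 0 and at y = 1/\<beta> with digit 1 the rule fails.\<close>

lemma region_branch:
  assumes "0 \<le> y" "y \<le> \<beta>" and y: "y \<noteq> 1 / \<beta>" "y \<noteq> 1"
  shows "region ((of_bool c + y) / \<beta>) =
    (if c then if region y = Sym_e0 then Sym_s else Sym_e1
     else if region y = Sym_e1 then Sym_s else Sym_e0)"
proof -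
  let ?x = "(of_bool c + y) / \<beta>"
  have x: "0 \<le> ?x" "?x \<le> \<beta>"
    using assms by (auto simp: divide_simps \<beta>_square)
  note r = region_e0_iff[OF x(1)] region_e1_iff[OF x(2)] region_e0_iff[OF assms(1)] region_e1_iff[OF assms(2)]
  show ?thesis
  proof (cases c)
    case True
    then have "1 < ?x \<longleftrightarrow> \<beta> - 1 < y" "\<not> ?x < 1 / \<beta>"
      using assms by (auto simp: divide_simps)
    with True r y \<beta>_inverse show ?thesis
      by (cases "region ?x") auto
  next
    case False
    then have "?x < 1 / \<beta> \<longleftrightarrow> y < 1" "\<not> ?x > 1"
      using assms by (auto simp: divide_simps)
    with False r y show ?thesis
      by (cases "region ?x") auto
  qed
qed

lemma region_case_nat:
  assumes "b \<in> typical"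
  shows "region (val (case_nat c b)) =
    (if c then if region (val b) = Sym_e0 then Sym_s else Sym_e1
     else if region (val b) = Sym_e1 then Sym_s else Sym_e0)"
proof -
  have "val ((shift ^^ 0) b) \<notin> {0, 1 / \<beta>, 1, \<beta>}"
    using assms unfolding typical_def by blast
  then show ?thesis
    unfolding val_case_nat by (intro region_branch) auto
qed

lemma sel_rec:
  assumes "b \<in> visits"
  shows "sel n b = (if region (val b) = Sym_s then case_nat (b 0) (\<lambda>i. sel i (shift b)) n
    else sel n (shift b))"
  using sel_in_S[of b] sel_notin_S[OF assms] by (simp add: region_s_iff split: nat.split del: sel.simps)

text \<open>
  The solution of the linear equations in the proof of \<open>measure_region_sel\<close> below.
\<close>

definition region_prob :: "real \<Rightarrow> symbol \<Rightarrow> real" where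
  "region_prob p s = (case s of Sym_e0 \<Rightarrow> p\<^sup>2 | Sym_s \<Rightarrow> p * (1 - p) | Sym_e1 \<Rightarrow> (1 - p)\<^sup>2)
    / (1 - p * (1 - p))"

lemma region_prob_pos:
  assumes "0 < p" "p < 1"
  shows "region_prob p s > 0"
proof -
  have "p * (1 - p) < 1 * 1" using assms by (intro mult_strict_mono) auto
  then show ?thesis using assms by (cases s) (simp_all add: region_prob_def)
qed

lemma sum_region_prob:
  assumes "0 < p" "p < 1"
  shows "region_prob p Sym_e0 + region_prob p Sym_s + region_prob p Sym_e1 = 1"
proof -
  have "p * (1 - p) < 1 * 1" using assms by (intro mult_strict_mono) auto
  then show ?thesis
    by (simp add: region_prob_def add_divide_distrib[symmetric])
       (simp add: power2_eq_square algebra_simps)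
qed

lemma measure_cong_typical:
  assumes "0 < p" "p < 1"
    and "\<And>b. b \<in> typical \<Longrightarrow> P b \<longleftrightarrow> Q b"
    and [measurable]: "Measurable.pred seqs P" "Measurable.pred seqs Q"
  shows "measure (m p) {b. P b} = measure (m p) {b. Q b}"
proof (rule measure_eq_AE)
  show "AE b in m p. b \<in> {b. P b} \<longleftrightarrow> b \<in> {b. Q b}"
    using AE_typical[OF assms(1,2)] by eventually_elim (use assms(3) in simp)
qed (use assms(4,5) in \<open>simp_all add: pred_def space_PiM\<close>)

text \<open>
  Note the \<^term>\<open>bernoulli_pmf p\<close>, not \<^term>\<open>bernoulli_pmf (1 - p)\<close>: on \<^const>\<open>S\<close> the weights of the
  digits 0 and 1 are interchanged, because after the digit 0 the orbit passes through \<^const>\<open>E\<^sub>1\<close>, which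
  is reached with odds \<open>(1 - p)\<^sup>2 : p\<^sup>2\<close> relative to \<^const>\<open>E\<^sub>0\<close>.
\<close>

lemma measure_region_sel:
  assumes p: "0 < p" "p < 1"
  shows "measure (m p) {b. region (val b) = s \<and> (\<forall>i<n. sel i b \<in> A i)} =
    region_prob p s * (\<Prod>i<n. measure (bernoulli_pmf p) (A i))"
proof -
  define W where "W = (\<lambda>n A b. \<forall>i<n. sel i b \<in> (A i :: bool set))"
  define F where "F = (\<lambda>s n A. measure (m p) {b. region (val b) = s \<and> W n A b})"
  have [measurable]: "Measurable.pred seqs (W n A)" for n A
    unfolding W_def by measurable
  interpret prob_space "m p" by (rule prob_space_m)
  have vis: "case_nat c b \<in> visits" if "b \<in> typical" for c b
    using typical_visits[OF that] visits_shift_iff[of "case_nat c b"] by simp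
  have W: "W n A (case_nat c b) \<longleftrightarrow> W n A b"
    if "b \<in> typical" "region (val (case_nat c b)) \<noteq> Sym_s" for n A c b
    using that sel_rec[OF vis[OF that(1)], of _ c] by (simp add: W_def del: sel.simps)
  have W_S: "W (Suc n) A (case_nat c b) \<longleftrightarrow> c \<in> A 0 \<and> W n (\<lambda>i. A (Suc i)) b"
    if "b \<in> typical" "region (val (case_nat c b)) = Sym_s" for n A c b
    using that sel_rec[OF vis[OF that(1)], of _ c]
    by (simp add: W_def All_less_Suc2 del: sel.simps)
  have [measurable]: "Measurable.pred seqs (\<lambda>b. W n A (case_nat c b))" for n A c
    by (rule pred_case_nat) measurable
  have [measurable]: "Measurable.pred seqs (\<lambda>b. region (val (case_nat c b)) = s)" for c s
    by (rule pred_case_nat) measurable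
  have rec: "F s n A = p * measure (m p) {b. region (val (case_nat False b)) = s \<and> W n A (case_nat False b)}
      + (1 - p) * measure (m p) {b. region (val (case_nat True b)) = s \<and> W n A (case_nat True b)}" for s n A
    unfolding F_def by (rule m_Collect_rec[OF p]) measurable
  have disj: "measure (m p) {b. region (val b) = s \<and> W n A b \<or> region (val b) = t \<and> W n A b} = F s n A + F t n A"
    if "s \<noteq> t" for s t n A
    unfolding F_def using that by (intro measure_m_disj) auto
  note cong = measure_cong_typical[OF p]
  \<comment> \<open>\<open>Sym_e0\<close> arises exactly from the digit 0 followed by
    \<open>Sym_e0\<close> or \<open>Sym_s\<close>, and no choice is consumed.\<close>
  have F0: "F Sym_e0 n A = p * (F Sym_e0 n A + F Sym_s n A)" for n A
  proof -
    have "measure (m p) {b. region (val (case_nat False b)) = Sym_e0 \<and> W n A (case_nat False b)}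
        = measure (m p) {b. (region (val b) = Sym_e0 \<and> W n A b) \<or> (region (val b) = Sym_s \<and> W n A b)}"
      by (rule cong) (auto simp: region_case_nat W, metis symbol.exhaust)
    moreover have "measure (m p) {b. region (val (case_nat True b)) = Sym_e0 \<and> W n A (case_nat True b)}
        = measure (m p) {b. False}"
      by (rule cong) (auto simp: region_case_nat)
    ultimately show ?thesis
      by (subst rec) (simp add: disj)
  qed
  have F1: "F Sym_e1 n A = (1 - p) * (F Sym_e1 n A + F Sym_s n A)" for n A
  proof -
    have "measure (m p) {b. region (val (case_nat True b)) = Sym_e1 \<and> W n A (case_nat True b)}
        = measure (m p) {b. (region (val b) = Sym_e1 \<and> W n A b) \<or> (region (val b) = Sym_s \<and> W n A b)}"
      by (rule cong) (auto simp: region_case_nat W, metis symbol.exhaust)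
    moreover have "measure (m p) {b. region (val (case_nat False b)) = Sym_e1 \<and> W n A (case_nat False b)}
        = measure (m p) {b. False}"
      by (rule cong) (auto simp: region_case_nat)
    ultimately show ?thesis
      by (subst rec) (simp add: disj)
  qed
  \<comment> \<open>\<open>Sym_s\<close> arises from 0 followed by \<open>Sym_e1\<close> or from 1
    followed by \<open>Sym_e0\<close>. The digit is itself the first choice, so it is tested against
    \<open>A 0\<close> and the remaining conditions move down by one.\<close>
  have FS: "F Sym_s (Suc n) A = of_bool (False \<in> A 0) * p * F Sym_e1 n (\<lambda>i. A (Suc i))
      + of_bool (True \<in> A 0) * (1 - p) * F Sym_e0 n (\<lambda>i. A (Suc i))" for n A
  proof -
    have "measure (m p) {b. region (val (case_nat False b)) = Sym_s \<and> W (Suc n) A (case_nat False b)}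
        = measure (m p) {b. False \<in> A 0 \<and> region (val b) = Sym_e1 \<and> W n (\<lambda>i. A (Suc i)) b}"
      by (rule cong) (auto simp: region_case_nat W_S)
    moreover have "measure (m p) {b. region (val (case_nat True b)) = Sym_s \<and> W (Suc n) A (case_nat True b)}
        = measure (m p) {b. True \<in> A 0 \<and> region (val b) = Sym_e0 \<and> W n (\<lambda>i. A (Suc i)) b}"
      by (rule cong) (auto simp: region_case_nat W_S)
    ultimately show ?thesis
      by (subst rec) (simp add: F_def)
  qed
  have F0': "F Sym_e0 n A = p / (1 - p) * F Sym_s n A" for n A
    using F0[of n A] p by (simp add: field_simps)
  have F1': "F Sym_e1 n A = (1 - p) / p * F Sym_s n A" for n A
    using F1[of n A] p by (simp add: field_simps)
  have c: "p * (1 - p) < 1 * 1" using p by (intro mult_strict_mono) auto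
  have sum: "F Sym_e0 0 A + F Sym_s 0 A + F Sym_e1 0 A = 1" for A
  proof -
    have "F Sym_e0 0 A + F Sym_s 0 A + F Sym_e1 0 A =
        measure (m p) {b. (region (val b) = Sym_e0 \<or> region (val b) = Sym_s) \<or> region (val b) = Sym_e1}"
      using disj[of Sym_e0 Sym_s 0 A]
      by (subst measure_m_disj) (auto simp: F_def W_def)
    also have "\<dots> = measure (m p) UNIV"
      by (rule arg_cong[where f = "measure (m p)"]) (use symbol.exhaust in blast)
    also have "\<dots> = 1"
      using prob_space by simp
    finally show ?thesis .
  qed
  \<comment> \<open>With \<open>F0'\<close> and \<open>F1'\<close>, the normalisation
    \<open>sum\<close> becomes one equation for \<open>F Sym_s 0 A\<close>.\<close>
  have S0: "F Sym_s 0 A = region_prob p Sym_s" for A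
    using sum[of A] c p unfolding F0' F1'
    by (simp add: region_prob_def divide_simps) (simp add: algebra_simps)
  have S: "F Sym_s n A = region_prob p Sym_s * (\<Prod>i<n. measure (bernoulli_pmf p) (A i))" for n A
  proof (induction n arbitrary: A)
    case 0
    show ?case by (simp add: S0)
  next
    case (Suc n)
    have b: "measure (bernoulli_pmf p) B = of_bool (False \<in> B) * (1 - p) + of_bool (True \<in> B) * p" for B
    proof -
      have "measure (bernoulli_pmf p) B = (\<Sum>c\<in>UNIV. if c \<in> B then pmf (bernoulli_pmf p) c else 0)"
        by (simp add: measure_measure_pmf_finite sum.If_cases)
      then show ?thesis using p by (simp add: UNIV_bool)
    qed
    \<comment> \<open>Relative to \<open>F Sym_s n\<close>, the digit 0 has weight p * ((1 - p) / p)
      = 1 - p and the digit 1 has weight (1 - p) * (p / (1 - p)) = p.\<close>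
    have "F Sym_s (Suc n) A = measure (bernoulli_pmf p) (A 0) * F Sym_s n (\<lambda>i. A (Suc i))"
      unfolding FS F0' F1' b using p by (simp add: field_simps)
    then show ?case
      by (simp add: Suc prod.lessThan_Suc_shift del: prod.lessThan_Suc)
  qed
  have "F s n A = region_prob p s * (\<Prod>i<n. measure (bernoulli_pmf p) (A i))"
    using p c by (cases s) (simp_all add: F0' F1' S region_prob_def power2_eq_square)
  then show ?thesis by (simp add: F_def W_def)
qed

text \<open>Summing \<open>measure_region_sel\<close> over the three regions removes the factor
  \<open>region_prob\<close>.\<close>

lemma measure_sel:
  assumes p: "0 < p" "p < 1"
  shows "measure (m p) {b. \<forall>i<n. sel i b \<in> A i} = (\<Prod>i<n. measure (bernoulli_pmf p) (A i))"
proof -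
  define W where "W = (\<lambda>b. \<forall>i<n. sel i b \<in> A i)"
  define R where "R = (\<lambda>s b. region (val b) = s \<and> W b)"
  have [measurable]: "Measurable.pred seqs (R s)" for s
    unfolding R_def W_def by measurable
  have "W b \<longleftrightarrow> (R Sym_e0 b \<or> R Sym_s b) \<or> R Sym_e1 b" for b
    unfolding R_def by (cases "region (val b)") auto
  then have "measure (m p) {b. W b} = measure (m p) {b. (R Sym_e0 b \<or> R Sym_s b) \<or> R Sym_e1 b}"
    by presburger
  also have "\<dots> = measure (m p) {b. R Sym_e0 b \<or> R Sym_s b} + measure (m p) {b. R Sym_e1 b}"
    by (rule measure_m_disj) (measurable, auto simp: R_def)
  also have "measure (m p) {b. R Sym_e0 b \<or> R Sym_s b} = measure (m p) {b. R Sym_e0 b} + measure (m p) {b. R Sym_s b}"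
    by (rule measure_m_disj) (measurable, auto simp: R_def)
  finally have "measure (m p) {b. W b} = measure (m p) {b. R Sym_e0 b} + measure (m p) {b. R Sym_s b}
    + measure (m p) {b. R Sym_e1 b}" .
  then show ?thesis
    unfolding R_def W_def measure_region_sel[OF p]
    by (simp add: distrib_right[symmetric] sum_region_prob[OF p])
qed

lemma distr_sel:
  assumes p: "0 < p" "p < 1"
  shows "distr (m p) (m (1 - p)) (\<lambda>b n. sel n b) = m (1 - p)"
proof -
  interpret product_prob_space "\<lambda>_. measure_pmf (bernoulli_pmf p)" "UNIV :: nat set"
    by unfold_locales
  interpret m: prob_space "m p" by (rule prob_space_m)
  have sel [measurable]: "(\<lambda>b n. sel n b) \<in> measurable (m p) (m (1 - p))"
    using measurable_PiM_single'[of UNIV sel seqs "\<lambda>_. count_space UNIV"] by (simp add: space_PiM)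
  have m: "m (1 - p) = Pi\<^sub>M UNIV (\<lambda>_. measure_pmf (bernoulli_pmf p))"
    by (simp add: m_def)
  have "distr (m p) (m (1 - p)) (\<lambda>b n. sel n b) = Pi\<^sub>M UNIV (\<lambda>_. measure_pmf (bernoulli_pmf p))"
  proof (rule PiM_eq)
    show "sets (distr (m p) (m (1 - p)) (\<lambda>b n. sel n b)) = sets (Pi\<^sub>M UNIV (\<lambda>_. measure_pmf (bernoulli_pmf p)))"
      by (simp add: m)
    fix J :: "nat set" and F :: "nat \<Rightarrow> bool set"
    assume J: "finite J"
    then obtain n where n: "J \<subseteq> {..<n}"
      by (metis finite_nat_iff_bounded)
    \<comment> \<open>Coordinates outside \<open>J\<close> get the trivial condition, so that a
      cylinder over \<open>J\<close> becomes a condition on an initial segment.\<close>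
    let ?A = "\<lambda>i. if i \<in> J then F i else UNIV"
    have *: "prod_emb UNIV (\<lambda>_. measure_pmf (bernoulli_pmf p)) J (Pi\<^sub>E J F) = {b. \<forall>j\<in>J. b j \<in> F j}"
      by (auto simp: prod_emb_def PiE_iff)
    have "{b. \<forall>j\<in>J. b j \<in> F j} \<in> sets (m (1 - p))"
      unfolding *[symmetric] m using J by (intro sets_PiM_I) auto
    then have "emeasure (distr (m p) (m (1 - p)) (\<lambda>b n. sel n b)) {b. \<forall>j\<in>J. b j \<in> F j} =
        emeasure (m p) {b. \<forall>j\<in>J. sel j b \<in> F j}"
      by (subst emeasure_distr) (auto simp: vimage_def)
    also have "{b. \<forall>j\<in>J. sel j b \<in> F j} = {b. \<forall>i<n. sel i b \<in> ?A i}"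
      using n by auto
    also have "emeasure (m p) \<dots> = (\<Prod>i<n. measure (bernoulli_pmf p) (?A i))"
      unfolding m.emeasure_eq_measure measure_sel[OF p] ..
    also have "\<dots> = (\<Prod>i\<in>J. measure (bernoulli_pmf p) (F i))"
      using n by (subst prod.mono_neutral_right[of "{..<n}" J]) (auto simp: measure_pmf.prob_space)
    finally show "emeasure (distr (m p) (m (1 - p)) (\<lambda>b n. sel n b))
        (prod_emb UNIV (\<lambda>_. measure_pmf (bernoulli_pmf p)) J (Pi\<^sub>E J F)) =
        (\<Prod>j\<in>J. emeasure (measure_pmf (bernoulli_pmf p)) (F j))"
      by (simp add: * measure_pmf.emeasure_eq_measure prod_ennreal)
  qed
  then show ?thesis by (simp add: m)
qed

subsection \<open>Digit frequencies\<close>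

lemma indep_vars_m: "prob_space.indep_vars (m p) (\<lambda>_. count_space UNIV) (\<lambda>i b. b i) UNIV"
proof -
  interpret product_prob_space "\<lambda>_. measure_pmf (bernoulli_pmf (1 - p))" "UNIV :: nat set"
    by unfold_locales
  interpret prob_space "m p" by (rule prob_space_m)
  have "distr (m p) (count_space UNIV) (\<lambda>b. b i) = measure_pmf (bernoulli_pmf (1 - p))" for i
    using PiM_component[of i] unfolding m_def by (subst distr_cong[OF refl _ refl]) auto
  moreover have "distr (m p) seqs (\<lambda>b. b) = m p"
    by (rule distr_id2) simp
  ultimately show ?thesis
    by (subst indep_vars_iff_distr_eq_PiM') (simp_all add: m_def restrict_UNIV)
qed

text \<open>The strong law for digits: Hoeffding's inequality bounds the tails by a geometric
  sequence, and Borel-Cantelli is applied to the countably many tolerances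
  \<open>1 / Suc j\<close>.\<close>

lemma AE_m_frequency:
  assumes p: "0 < p" "p < 1"
  shows "AE b in m p. (\<lambda>n. (\<Sum>i<n. of_bool (b i)) / real n) \<longlonglongrightarrow> 1 - p"
proof -
  interpret product_prob_space "\<lambda>_. measure_pmf (bernoulli_pmf (1 - p))" "UNIV :: nat set"
    by unfold_locales
  interpret prob_space "m p" by (rule prob_space_m)
  let ?X = "\<lambda>i b. of_bool (b i) :: real"
  have distr: "distr (m p) borel (?X i) = distr (measure_pmf (bernoulli_pmf (1 - p))) borel of_bool" for i
  proof -
    let ?B = "measure_pmf (bernoulli_pmf (1 - p))"
    have "distr (m p) borel (?X i) = distr (distr (m p) ?B (\<lambda>b. b i)) borel of_bool"
      by (subst distr_distr) (auto simp: comp_def)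
    also have "distr (m p) ?B (\<lambda>b. b i) = ?B"
      unfolding m_def by (rule PiM_component) simp
    finally show ?thesis .
  qed
  have "expectation (?X 0) = integral\<^sup>L (distr (m p) borel (?X 0)) (\<lambda>x. x)"
    by (subst integral_distr) auto
  also have "\<dots> = 1 - p"
    unfolding distr using p by (subst integral_distr) auto
  finally have exp: "expectation (?X 0) = 1 - p" .
  have tail: "prob {b. \<bar>(\<Sum>i<n. ?X i b) / real n - (1 - p)\<bar> \<ge> e} \<le> 2 * exp (- 2 * e\<^sup>2) ^ n"
    if e: "e > 0" for e n
  proof (cases "n = 0")
    case True
    then show ?thesis using order_trans[OF prob_le_1, of 2] by simp
  next
    case False
    interpret Hoeffding_ineq_iid "m p" "{..<n}" ?X "?X 0" 0 1 "expectation (?X 0)"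
    proof unfold_locales
      have "indep_vars (\<lambda>_. borel) (\<lambda>i. of_bool \<circ> (\<lambda>b. b i)) {..<n}"
        by (rule indep_vars_compose[OF indep_vars_subset[OF indep_vars_m]]) auto
      then show "indep_vars (\<lambda>_. borel) ?X {..<n}" by (simp add: comp_def)
    qed (auto simp: distr)
    show ?thesis
      using Hoeffding_ineq_abs_ge'[of e] False e
      by (simp add: exp exp_of_nat_mult[symmetric] mult_ac lessThan_empty_iff)
  qed
  have "AE b in m p. \<forall>j. \<forall>\<^sub>F n in sequentially. \<bar>(\<Sum>i<n. ?X i b) / real n - (1 - p)\<bar> < 1 / Suc j"
    unfolding AE_all_countable
  proof
    fix j
    let ?A = "\<lambda>n. {b \<in> space (m p). \<bar>(\<Sum>i<n. ?X i b) / real n - (1 - p)\<bar> \<ge> 1 / Suc j}"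
    have "AE b in m p. \<forall>\<^sub>F n in sequentially. b \<in> space (m p) - ?A n"
    proof (rule borel_cantelli_AE1)
      show "?A n \<in> sets (m p)" for n by measurable
      have "summable (\<lambda>n. 2 * exp (- 2 * (1 / real (Suc j))\<^sup>2) ^ n)"
        by (intro summable_mult summable_geometric) (simp del: of_nat_Suc)
      then show "summable (\<lambda>n. prob (?A n))"
        by (rule summable_comparison_test'[where N = 0]) (use tail[of "1 / Suc j"] in simp)
    qed (auto simp: emeasure_eq_measure)
    then show "AE b in m p. \<forall>\<^sub>F n in sequentially. \<bar>(\<Sum>i<n. ?X i b) / real n - (1 - p)\<bar> < 1 / Suc j"
      by (simp add: not_le)
  qed
  then show ?thesis
  proof eventually_elim
    case (elim b)
    show ?case
    proof (rule tendstoI)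
      fix e :: real assume "e > 0"
      then obtain j where j: "1 / Suc j < e" by (rule nat_approx_posE)
      show "\<forall>\<^sub>F n in sequentially. dist ((\<Sum>i<n. ?X i b) / real n) (1 - p) < e"
        unfolding dist_real_def using elim[rule_format, of j] by (rule eventually_mono) (use j in linarith)
    qed
  qed
qed

lemma AE_sel_frequency:
  assumes p: "0 < p" "p < 1"
  shows "AE b in m p. (\<lambda>n. (\<Sum>i<n. of_bool (sel i b)) / real n) \<longlonglongrightarrow> p"
proof -
  have sel: "(\<lambda>b n. sel n b) \<in> measurable (m p) (m (1 - p))"
    using measurable_PiM_single'[of UNIV sel seqs "\<lambda>_. count_space UNIV"] by (simp add: space_PiM)
  have "AE b in distr (m p) (m (1 - p)) (\<lambda>b n. sel n b).
      (\<lambda>n. (\<Sum>i<n. of_bool (b i)) / real n) \<longlonglongrightarrow> p"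
    unfolding distr_sel[OF p] using AE_m_frequency[of "1 - p"] p by simp
  from AE_distrD[OF sel this] show ?thesis .
qed

subsection \<open>Cylinders\<close>

text \<open>The visit count \<open>M\<close> as a natural number, so that it can serve as an index
  bound.\<close>

definition count_S :: "nat \<Rightarrow> point \<Rightarrow> nat" where
  "count_S k z = (\<Sum>j<k. of_bool (coding j z = Sym_s))"

lemma coding_Suc: "coding (Suc j) z = coding j (K z)"
  by (simp add: coding_eq funpow_swap1)

lemma digit_Suc: "digit (Suc j) z = digit j (K z)"
  by (simp add: digit_def funpow_swap1)

lemma count_S_Suc: "count_S (Suc k) z = of_bool (coding 0 z = Sym_s) + count_S k (K z)"
  unfolding count_S_def sum.lessThan_Suc_shift coding_Suc by simp

lemma count_S_le: "count_S k z \<le> k"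
proof -
  have "count_S k z \<le> (\<Sum>j<k. 1)"
    unfolding count_S_def by (intro sum_mono) simp
  then show ?thesis by simp
qed

lemma coding_eq_s_iff: "z \<in> X \<Longrightarrow> coding j z = Sym_s \<longleftrightarrow> (K ^^ j) z \<in> UNIV \<times> S"
  using K_funpow_in_X[of z j] region_s_iff[of "snd ((K ^^ j) z)"]
  by (auto simp: coding_eq X_def mem_Times_iff)

lemma M_eq_count_S: "z \<in> X \<Longrightarrow> M k z = real (count_S k z)"
  by (simp add: M_def count_S_def coding_eq_s_iff indicator_def)

text \<open>The counterpart of \<open>typical\<close> for points: the orbit avoids the two values at
  which \<open>region_branch\<close> can fail.\<close>

definition interior_points :: "point set" where
  "interior_points = {z \<in> X. \<forall>n. snd ((K ^^ n) z) \<notin> {1 / \<beta>, 1}}"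

lemma interior_points_sets [measurable]: "interior_points \<in> sets points"
proof -
  have "{z \<in> space points. \<forall>n. snd ((K ^^ n) z) \<notin> {1 / \<beta>, 1}} \<in> sets points"
    by measurable
  then show ?thesis by (simp add: interior_points_def)
qed

lemma K_interior_points: "z \<in> interior_points \<Longrightarrow> K z \<in> interior_points"
proof -
  assume z: "z \<in> interior_points"
  then have "snd ((K ^^ Suc n) z) \<notin> {1 / \<beta>, 1}" for n
    unfolding interior_points_def by blast
  with z show ?thesis by (simp add: interior_points_def K_in_X funpow_swap1)
qed

lemma coding_0_branch:
  assumes "z \<in> interior_points"
  shows "coding 0 z = (if digit 0 z then if coding 0 (K z) = Sym_e0 then Sym_s else Sym_e1
     else if coding 0 (K z) = Sym_e1 then Sym_s else Sym_e0)"
proof -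
  have z: "z \<in> X" and "snd ((K ^^ 1) z) \<notin> {1 / \<beta>, 1}"
    using assms unfolding interior_points_def by blast+
  then have "0 \<le> snd (K z)" "snd (K z) \<le> \<beta>" "snd (K z) \<noteq> 1 / \<beta>" "snd (K z) \<noteq> 1"
    using K_in_X[OF z] by (auto simp: X_def)
  moreover have "snd z = (of_bool (digit 0 z) + snd (K z)) / \<beta>"
    using snd_K[OF z] by (simp add: field_simps)
  ultimately show ?thesis
    using region_branch[of "snd (K z)" "digit 0 z"] by (simp add: coding_eq)
qed

lemma digit_0_cases:
  assumes "z \<in> X"
  shows "coding 0 z = Sym_e0 \<Longrightarrow> \<not> digit 0 z" "coding 0 z = Sym_e1 \<Longrightarrow> digit 0 z"
    "coding 0 z = Sym_s \<Longrightarrow> digit 0 z = fst z 0"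
  using assms disjoint_regions[of "snd z"] region_s_iff[of "snd z"]
  by (auto simp: coding_eq digit_def X_def region_def split: if_splits)

lemma fst_K:
  assumes "z \<in> X"
  shows "fst (K z) = (if coding 0 z = Sym_s then shift (fst z) else fst z)"
  using assms disjoint_regions[of "snd z"]
  by (auto simp: coding_eq X_def region_def K_def split: if_splits prod.splits)

text \<open>The two lengths are separate because a step of \<open>K\<close> always removes one
  region condition, but removes a condition on \<open>sel\<close> only at a visit to
  \<open>S\<close>.\<close>

definition cyl :: "nat \<Rightarrow> nat \<Rightarrow> point \<Rightarrow> (nat \<Rightarrow> bool) \<Rightarrow> bool" where
  "cyl k n z b \<longleftrightarrow> (\<forall>j<k. region (val ((shift ^^ j) b)) = coding j z) \<and> (\<forall>i<n. sel i b = fst z i)"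

lemma pred_cyl [measurable]: "Measurable.pred seqs (cyl k n z)"
  unfolding cyl_def[abs_def] by measurable

text \<open>The first region is determined by the first digit and the next region, so it can be
  traded for the digit. \<open>Suc (Suc k)\<close> leaves a region condition on the tail, and
  \<open>0 < n\<close> makes a visit to \<open>S\<close> at time 0 test the digit.\<close>

lemma cyl_case_nat:
  assumes b: "b \<in> typical" and z: "z \<in> interior_points" and n: "0 < n"
  shows "cyl (Suc (Suc k)) n z (case_nat c b) \<longleftrightarrow>
    c = digit 0 z \<and> cyl (Suc k) (n - of_bool (coding 0 z = Sym_s)) (K z) b"
proof -
  have X: "z \<in> X" using z by (simp add: interior_points_def)
  have vis: "case_nat c b \<in> visits"
    using typical_visits[OF b] visits_shift_iff[of "case_nat c b"] by simp
  let ?R = "region (val (case_nat c b))"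
  have split: "(\<forall>j<Suc (Suc k). region (val ((shift ^^ j) (case_nat c b))) = coding j z) \<longleftrightarrow>
      ?R = coding 0 z \<and> (\<forall>j<Suc k. region (val ((shift ^^ j) b)) = coding j (K z))"
    unfolding All_less_Suc2[of "Suc k"] by (simp add: coding_Suc funpow_swap1)
  have first: "region (val b) = coding 0 (K z)" if "\<forall>j<Suc k. region (val ((shift ^^ j) b)) = coding j (K z)"
    using that[THEN spec, of 0] by (simp only: funpow_0 zero_less_Suc simp_thms)
  have sel: "(\<forall>i<n. sel i (case_nat c b) = fst z i) \<longleftrightarrow>
      (coding 0 z = Sym_s \<longrightarrow> c = fst z 0) \<and> (\<forall>i<n - of_bool (coding 0 z = Sym_s). sel i b = fst (K z) i)"
    if "?R = coding 0 z"
  proof (cases "coding 0 z = Sym_s")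
    case True
    obtain n' where "n = Suc n'" using n by (cases n) auto
    then show ?thesis
      using True that sel_rec[OF vis] fst_K[OF X] by (simp add: All_less_Suc2 shift_apply del: sel.simps)
  next
    case False
    then show ?thesis using that sel_rec[OF vis] fst_K[OF X] by (simp del: sel.simps)
  qed
  show ?thesis
  proof (cases "?R = coding 0 z \<and> region (val b) = coding 0 (K z)")
    case True
    have "\<not> c" if "?R = Sym_e0"
      using that unfolding region_case_nat[OF b] by (simp split: if_splits)
    moreover have "c" if "?R = Sym_e1"
      using that unfolding region_case_nat[OF b] by (simp split: if_splits)
    \<comment> \<open>Off \<open>S\<close> the region already forces the digit, so both sides hold;
      on \<open>S\<close> the digit of z is its first choice.\<close>
    ultimately have c: "c = digit 0 z \<longleftrightarrow> (coding 0 z = Sym_s \<longrightarrow> c = fst z 0)"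
      using True digit_0_cases[OF X] by (metis (full_types) symbol.exhaust)
    show ?thesis
      unfolding cyl_def split c sel[OF conjunct1[OF True]] using True by argo
  next
    case False
    moreover have "?R = coding 0 z" if "region (val b) = coding 0 (K z)" "c = digit 0 z"
      using that region_case_nat[OF b, of c] coding_0_branch[OF z] by simp
    ultimately show ?thesis
      unfolding cyl_def split using first by argo
  qed
qed

text \<open>Induction on k, peeling off one digit at a time; \<open>measure_region_sel\<close> is
  the base case. The choices made before time k are among the first k digits, so only those from
  index \<open>count_S k z\<close> on give further factors. \<open>k < n\<close> keeps a choice
  available at every step.\<close>

lemma measure_cyl:
  assumes p: "0 < p" "p < 1" and "z \<in> interior_points" "k < n"
  shows "measure (m p) {b. cyl (Suc k) n z b} =
    (\<Prod>j<k. pmf (bernoulli_pmf (1 - p)) (digit j z)) * region_prob p (coding k z)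
    * (\<Prod>i\<in>{count_S k z..<n}. pmf (bernoulli_pmf p) (fst z i))"
  using assms(3,4)
proof (induction k arbitrary: z n)
  case 0
  have "{b. cyl (Suc 0) n z b} = {b. region (val b) = coding 0 z \<and> (\<forall>i<n. sel i b \<in> {fst z i})}"
    by (simp add: cyl_def)
  then show ?case
    using measure_region_sel[OF p, of "coding 0 z" n "\<lambda>i. {fst z i}"]
    by (simp add: count_S_def measure_pmf_single atLeast0LessThan)
next
  case (Suc k)
  have X: "z \<in> X" using Suc.prems by (simp add: interior_points_def)
  define e :: nat where "e = of_bool (coding 0 z = Sym_s)"
  have e: "e \<le> 1" by (simp add: e_def)
  let ?cyl = "\<lambda>b. cyl (Suc k) (n - e) (K z) b"
  have "measure (m p) {b. cyl (Suc (Suc k)) n z (case_nat c b)} = measure (m p) {b. c = digit 0 z \<and> ?cyl b}" for c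
  proof (rule measure_cong_typical[OF p])
    show "Measurable.pred seqs (\<lambda>b. cyl (Suc (Suc k)) n z (case_nat c b))"
      by (rule pred_case_nat[OF pred_cyl])
    show "cyl (Suc (Suc k)) n z (case_nat c b) \<longleftrightarrow> c = digit 0 z \<and> ?cyl b" if "b \<in> typical" for b
      unfolding e_def using that Suc.prems by (intro cyl_case_nat) auto
  qed measurable
  then have "measure (m p) {b. cyl (Suc (Suc k)) n z b} =
      pmf (bernoulli_pmf (1 - p)) (digit 0 z) * measure (m p) {b. ?cyl b}"
    using p by (cases "digit 0 z"; subst m_Collect_rec[OF p]) auto
  also have "measure (m p) {b. ?cyl b} =
      (\<Prod>j<k. pmf (bernoulli_pmf (1 - p)) (digit j (K z))) * region_prob p (coding k (K z))
      * (\<Prod>i\<in>{count_S k (K z)..<n - e}. pmf (bernoulli_pmf p) (fst (K z) i))"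
    using e Suc.prems by (intro Suc.IH K_interior_points) auto
  also have "(\<Prod>i\<in>{count_S k (K z)..<n - e}. pmf (bernoulli_pmf p) (fst (K z) i)) =
      (\<Prod>i\<in>{count_S k (K z)..<n - e}. pmf (bernoulli_pmf p) (fst z (i + e)))"
    by (rule prod.cong) (simp_all add: fst_K[OF X] e_def shift_apply)
  \<comment> \<open>The first step consumed \<open>e\<close> choices, and
    \<open>count_S (Suc k) z\<close> is \<open>e + count_S k (K z)\<close>.\<close>
  also have "\<dots> = (\<Prod>i\<in>{count_S (Suc k) z..<n}. pmf (bernoulli_pmf p) (fst z i))"
    using e Suc.prems by (subst prod.shift_bounds_nat_ivl[symmetric]) (simp add: count_S_Suc e_def add.commute)
  finally show ?case
    by (simp add: coding_Suc digit_Suc prod.lessThan_Suc_shift del: prod.lessThan_Suc)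
qed

subsection \<open>Asymptotics\<close>

text \<open>Convergence to l is rewritten as the Cauchy property and an equation for the total
  function \<open>lim\<close>, both of which are measurable.\<close>

lemma pred_LIMSEQ:
  fixes f :: "nat \<Rightarrow> 'a \<Rightarrow> real"
  assumes [measurable]: "\<And>i. f i \<in> borel_measurable N"
  shows "Measurable.pred N (\<lambda>x. (\<lambda>i. f i x) \<longlonglongrightarrow> l)"
proof -
  have *: "X \<longlonglongrightarrow> l \<longleftrightarrow> Cauchy X \<and> lim X = l" for X :: "nat \<Rightarrow> real"
    by (metis Cauchy_convergent_iff convergent_LIMSEQ_iff convergentI limI)
  show ?thesis unfolding * by measurable
qed

text \<open>The logarithm of the weight is affine in the digit, so its average is an affine function
  of the digit frequency.\<close>

lemma frequency_imp_entropy: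
  assumes q: "0 < q" "q < 1" and "(\<lambda>n. (\<Sum>i<n. of_bool (b i)) / real n) \<longlonglongrightarrow> q"
  shows "(\<lambda>n. (\<Sum>i<n. ln (pmf (bernoulli_pmf q) (b i))) / real n) \<longlonglongrightarrow> - H q"
proof -
  let ?f = "\<lambda>n. (\<Sum>i<n. of_bool (b i)) / real n"
  have "(\<lambda>n. ln (1 - q) + ?f n * (ln q - ln (1 - q))) \<longlonglongrightarrow> ln (1 - q) + q * (ln q - ln (1 - q))"
    using assms(3) by (intro tendsto_intros)
  moreover have "ln (1 - q) + q * (ln q - ln (1 - q)) = - H q"
    by (simp add: H_def algebra_simps)
  moreover have "\<forall>\<^sub>F n in sequentially. ln (1 - q) + ?f n * (ln q - ln (1 - q)) =
      (\<Sum>i<n. ln (pmf (bernoulli_pmf q) (b i))) / real n"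
    using eventually_gt_at_top[of 0]
  proof eventually_elim
    case (elim n)
    have "ln (pmf (bernoulli_pmf q) (b i)) = ln (1 - q) + of_bool (b i) * (ln q - ln (1 - q))" for i
      using q by simp
    then have "(\<Sum>i<n. ln (pmf (bernoulli_pmf q) (b i))) =
        real n * ln (1 - q) + (\<Sum>i<n. of_bool (b i)) * (ln q - ln (1 - q))"
      by (simp only: sum.distrib sum_distrib_right) simp
    then show ?case using elim by (simp add: add_divide_distrib)
  qed
  ultimately show ?thesis
    by (simp add: tendsto_cong)
qed

lemma H_one_minus: "H (1 - p) = H p"
  by (simp add: H_def algebra_simps)

text \<open>\<open>N n\<close> need not tend to infinity. The finitely many early terms go into a
  constant C, so that the bound C + (e/2) n holds for all n and passes to the smaller index.\<close>

lemma sublinear_at_smaller_index: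
  fixes a :: "nat \<Rightarrow> real"
  assumes a: "(\<lambda>n. a n / real n) \<longlonglongrightarrow> 0" and N: "\<And>n. N n \<le> n"
  shows "(\<lambda>n. a (N n) / real n) \<longlonglongrightarrow> 0"
proof (rule tendstoI)
  fix e :: real assume e: "e > 0"
  then have "\<forall>\<^sub>F n in sequentially. \<bar>a n / real n\<bar> < e / 2"
    using tendstoD[OF a, of "e / 2"] by simp
  then obtain k where k: "\<And>n. n \<ge> k \<Longrightarrow> \<bar>a n / real n\<bar> < e / 2"
    by (auto simp: eventually_sequentially)
  define C where "C = (\<Sum>i\<le>k. \<bar>a i\<bar>)"
  have bound: "\<bar>a n\<bar> \<le> C + e / 2 * real n" for n
  proof (cases "n \<le> k")
    case True
    then have "\<bar>a n\<bar> \<le> C" unfolding C_def by (intro member_le_sum) auto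
    then show ?thesis using e by (simp add: add_increasing2)
  next
    case False
    moreover have "C \<ge> 0" by (simp add: C_def sum_nonneg)
    ultimately show ?thesis using k[of n] by (simp add: field_simps)
  qed
  have "(\<lambda>n. C / real n) \<longlonglongrightarrow> 0" by (rule lim_const_over_n)
  then have "\<forall>\<^sub>F n in sequentially. C / real n < e / 2"
    using e by (intro order_tendstoD(2)) auto
  then show "\<forall>\<^sub>F n in sequentially. dist (a (N n) / real n) 0 < e"
    using eventually_gt_at_top[of 0]
  proof eventually_elim
    case (elim n)
    have "e / 2 * real (N n) \<le> e / 2 * real n" using e N[of n] by (intro mult_left_mono) auto
    then have "\<bar>a (N n)\<bar> \<le> C + e / 2 * real n" using bound[of "N n"] by linarith
    then show ?case using elim by (simp add: field_simps)
  qed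
qed

section \<open>Regular points and the measure of balls\<close>

definition regular :: "real \<Rightarrow> point \<Rightarrow> bool" where
  "regular p z \<longleftrightarrow> z \<in> interior_points \<and>
     (\<lambda>n. (\<Sum>i<n. of_bool (digit i z)) / real n) \<longlonglongrightarrow> 1 - p \<and>
     (\<lambda>n. (\<Sum>i<n. of_bool (fst z i)) / real n) \<longlonglongrightarrow> p"

lemma point_of_interior:
  assumes "b \<in> typical"
  shows "point_of b \<in> interior_points"
  using assms typical_visits[OF assms]
  by (simp add: interior_points_def K_funpow_point_of) (simp add: typical_def point_of_def)

lemma AE_regular:
  assumes p: "0 < p" "p < 1"
  shows "AE z in \<nu> p. regular p z"
proof -
  have [measurable]: "Measurable.pred points (\<lambda>z. fst z i)" for i
    by measurable
  have "Measurable.pred points (regular p)"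
    unfolding regular_def[abs_def] by (intro pred_intros_logic pred_LIMSEQ) measurable
  then have m: "{z \<in> space points. regular p z} \<in> sets points"
    by (simp only: pred_def)
  have f: "point_of \<in> measurable (m p) points" by simp
  show ?thesis
    unfolding \<nu>_eq_distr[OF p] AE_distr_iff[OF f m]
    using AE_typical[OF p] AE_m_frequency[OF p] AE_sel_frequency[OF p]
  proof eventually_elim
    case (elim b)
    then have "digit i (point_of b) = b i" "fst (point_of b) i = sel i b" for i
      using \<phi>_point_of[OF typical_visits, of b] unfolding \<phi>_def fun_eq_iff by (auto simp: point_of_def)
    with elim show ?case by (simp add: regular_def point_of_interior)
  qed
qed

text \<open>The ball is open and r is at most \<beta> to the power -n, so a first difference at
  index n is too early: \<open>Suc n\<close> symbols and coordinates must agree. The strict lower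
  bound on r makes this sufficient.\<close>

lemma mball_eq:
  assumes z: "z \<in> X" and r: "0 < r" "(1 / \<beta>) ^ Suc n < r" "r \<le> (1 / \<beta>) ^ n"
  shows "Metric_space.mball X \<rho> z r =
    {z' \<in> X. \<forall>k<Suc n. coding k z' = coding k z \<and> fst z' k = fst z k}"
proof -
  interpret Metric_space X \<rho> by (rule Metric_space_\<rho>)
  have "\<rho> z z' < r \<longleftrightarrow> (\<forall>k<Suc n. coding k z' = coding k z \<and> fst z' k = fst z k)" if z': "z' \<in> X" for z'
  proof (cases "z = z'")
    case True
    then show ?thesis using r by (simp add: \<rho>_def)
  next
    case False
    define P where "P = (\<lambda>k. fst z k \<noteq> fst z' k \<or> coding k z \<noteq> coding k z')"
    define l where "l = (LEAST k. P k)"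
    have "\<exists>k. P k"
      using coding_separates[OF z z'] False by (auto simp: P_def fun_eq_iff)
    then have l: "P l" unfolding l_def by (rule LeastI_ex)
    have least: "l \<le> k" if "P k" for k unfolding l_def using that by (rule Least_le)
    have \<rho>: "\<rho> z z' = (1 / \<beta>) ^ l" using False by (simp add: \<rho>_def l_def P_def)
    have anti: "(1 / \<beta>) ^ j \<le> (1 / \<beta>) ^ i" if "i \<le> j" for i j
      using that by (intro power_decreasing) auto
    have "\<rho> z z' < r \<longleftrightarrow> Suc n \<le> l"
    proof (cases "Suc n \<le> l")
      case True
      then show ?thesis unfolding \<rho> using anti[OF True] r(2) by linarith
    next
      case False
      then show ?thesis unfolding \<rho> using anti[of l n] r(3) by linarith
    qed
    also have "\<dots> \<longleftrightarrow> (\<forall>k<Suc n. \<not> P k)"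
    proof
      assume "Suc n \<le> l"
      then show "\<forall>k<Suc n. \<not> P k" using least by fastforce
    next
      assume "\<forall>k<Suc n. \<not> P k"
      then show "Suc n \<le> l" using l not_less by blast
    qed
    finally show ?thesis by (auto simp: P_def)
  qed
  then show ?thesis using z by (auto simp: in_mball)
qed

lemma measure_mball:
  assumes p: "0 < p" "p < 1" and z: "z \<in> interior_points"
    and r: "0 < r" "(1 / \<beta>) ^ Suc n < r" "r \<le> (1 / \<beta>) ^ n"
  shows "measure (\<nu> p) (Metric_space.mball X \<rho> z r) =
    (\<Prod>j<n. pmf (bernoulli_pmf (1 - p)) (digit j z)) * region_prob p (coding n z)
    * (\<Prod>i\<in>{count_S n z..<Suc n}. pmf (bernoulli_pmf p) (fst z i))"
proof -
  let ?P = "\<lambda>z'. \<forall>k<Suc n. coding k z' = coding k z \<and> fst z' k = fst z k"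
  have X: "z \<in> X" using z by (simp add: interior_points_def)
  have f: "point_of \<in> measurable (m p) points" by simp
  have P: "Measurable.pred points ?P" by measurable
  have sets: "{z' \<in> X. ?P z'} \<in> sets points" using P unfolding pred_def space_points .
  have "measure (\<nu> p) (Metric_space.mball X \<rho> z r) = measure (m p) {b. ?P (point_of b)}"
    unfolding mball_eq[OF X r] \<nu>_eq_distr[OF p]
    by (subst measure_distr[OF f sets]) (simp only: vimage_def space_m Int_UNIV_right mem_Collect_eq point_of_in_X simp_thms)
  also have "\<dots> = measure (m p) {b. cyl (Suc n) (Suc n) z b}"
  proof (rule measure_cong_typical[OF p])
    show "?P (point_of b) \<longleftrightarrow> cyl (Suc n) (Suc n) z b" if "b \<in> typical" for b
    proof -
      have c: "coding k (point_of b) = region (val ((shift ^^ k) b))" "fst (point_of b) k = sel k b" for k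
        unfolding coding_eq K_funpow_point_of[OF typical_visits[OF that]] by (simp_all add: point_of_def)
      show ?thesis unfolding cyl_def c by blast
    qed
    show "Measurable.pred seqs (\<lambda>b. ?P (point_of b))"
      by (rule measurable_compose[OF measurable_point_of P])
  qed (rule pred_cyl)
  also have "\<dots> = (\<Prod>j<n. pmf (bernoulli_pmf (1 - p)) (digit j z)) * region_prob p (coding n z)
    * (\<Prod>i\<in>{count_S n z..<Suc n}. pmf (bernoulli_pmf p) (fst z i))"
    by (rule measure_cyl[OF p z]) simp
  finally show ?thesis .
qed

text \<open>The digits contribute - H(p), the choices with indices from \<open>count_S n z\<close>
  to n contribute - H(p)(1 - L), and the region factor takes only three values.\<close>

lemma cylinder_measure_exponent:
  assumes p: "0 < p" "p < 1" and reg: "regular p z"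
    and L: "(\<lambda>k. M k z / real k) \<longlonglongrightarrow> L"
  shows "(\<lambda>n. ln ((\<Prod>j<n. pmf (bernoulli_pmf (1 - p)) (digit j z)) * region_prob p (coding n z)
    * (\<Prod>i\<in>{count_S n z..<Suc n}. pmf (bernoulli_pmf p) (fst z i))) / real n) \<longlonglongrightarrow> - H p * (2 - L)"
proof -
  have X: "z \<in> X" using reg by (simp add: regular_def interior_points_def)
  have pos: "pmf (bernoulli_pmf q) b > 0" if "0 < q" "q < 1" for q b
    using that by (cases b) auto
  have pos_ne: "pmf (bernoulli_pmf p) b \<noteq> 0" "pmf (bernoulli_pmf (1 - p)) b \<noteq> 0" for b
    using p pos[of p b] pos[of "1 - p" b] by simp_all
  define A where "A = (\<lambda>n. \<Sum>j<n. ln (pmf (bernoulli_pmf (1 - p)) (digit j z)))"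
  define B where "B = (\<lambda>n. \<Sum>i<n. ln (pmf (bernoulli_pmf p) (fst z i)))"
  define N where "N = (\<lambda>n. count_S n z)"
  have A: "(\<lambda>n. A n / real n) \<longlonglongrightarrow> - H p"
    using frequency_imp_entropy[of "1 - p" "\<lambda>i. digit i z"] reg p
    by (simp add: A_def regular_def H_one_minus)
  have B: "(\<lambda>n. B n / real n) \<longlonglongrightarrow> - H p"
    using frequency_imp_entropy[of p "fst z"] reg p by (simp add: B_def regular_def)
  have N: "(\<lambda>n. real (N n) / real n) \<longlonglongrightarrow> L"
    using L by (simp add: M_eq_count_S[OF X] N_def)
  have R: "(\<lambda>n. ln (region_prob p (coding n z)) / real n) \<longlonglongrightarrow> 0"
  proof (rule Lim_null_comparison[OF _ lim_const_over_n])
    let ?l = "\<lambda>s. \<bar>ln (region_prob p s)\<bar>"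
    have "?l s \<le> ?l Sym_e0 + ?l Sym_s + ?l Sym_e1" for s
      by (cases s) auto
    then show "\<forall>\<^sub>F n in sequentially. norm (ln (region_prob p (coding n z)) / real n) \<le>
        (?l Sym_e0 + ?l Sym_s + ?l Sym_e1) / real n"
      by (intro always_eventually allI) (simp add: divide_right_mono)
  qed
  have BS: "(\<lambda>n. B (Suc n) / real n) \<longlonglongrightarrow> - H p"
  proof -
    have "(\<lambda>n. B (Suc n) / real (Suc n) * (real (Suc n) / real n)) \<longlonglongrightarrow> - H p * 1"
      by (intro tendsto_mult LIMSEQ_Suc[OF B] LIMSEQ_Suc_n_over_n)
    \<comment> \<open>At n = 0 both sides are 0, as division by zero gives 0.\<close>
    moreover have "B (Suc n) / real (Suc n) * (real (Suc n) / real n) = B (Suc n) / real n" for n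
      by simp
    ultimately show ?thesis by simp
  qed
  \<comment> \<open>If L = 0, \<open>N n\<close> may stay bounded, so \<open>N n\<close> cannot be
    substituted into the limit \<open>B\<close>. The deviation of \<open>B\<close> from its linear
    part is sublinear, which does pass to \<open>N n\<close>.\<close>
  have "(\<lambda>n. (B n + H p * real n) / real n) \<longlonglongrightarrow> 0"
  proof -
    have "(\<lambda>n. B n / real n + H p) \<longlonglongrightarrow> - H p + H p"
      by (intro tendsto_intros B)
    moreover have "\<forall>\<^sub>F n in sequentially. B n / real n + H p = (B n + H p * real n) / real n"
      using eventually_gt_at_top[of 0] by eventually_elim (simp add: field_simps)
    ultimately show ?thesis by (simp add: tendsto_cong)
  qed
  then have "(\<lambda>n. (B (N n) + H p * real (N n)) / real n) \<longlonglongrightarrow> 0"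
    by (rule sublinear_at_smaller_index) (simp add: N_def count_S_le)
  from tendsto_diff[OF this tendsto_mult_left[OF N, of "H p"]]
  have BN: "(\<lambda>n. B (N n) / real n) \<longlonglongrightarrow> - (H p * L)"
    by (simp add: add_divide_distrib)
  have eq: "ln ((\<Prod>j<n. pmf (bernoulli_pmf (1 - p)) (digit j z)) * region_prob p (coding n z)
      * (\<Prod>i\<in>{count_S n z..<Suc n}. pmf (bernoulli_pmf p) (fst z i))) =
      A n + ln (region_prob p (coding n z)) + (B (Suc n) - B (N n))" for n
  proof -
    have "B (Suc n) - B (N n) = (\<Sum>i\<in>{N n..<Suc n}. ln (pmf (bernoulli_pmf p) (fst z i)))"
      using sum_diff_nat_ivl[of 0 "N n" "Suc n" "\<lambda>i. ln (pmf (bernoulli_pmf p) (fst z i))"] count_S_le[of n z]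
      unfolding B_def N_def atLeast0LessThan by simp
    also have "\<dots> = ln (\<Prod>i\<in>{count_S n z..<Suc n}. pmf (bernoulli_pmf p) (fst z i))"
      unfolding N_def by (rule ln_prod[symmetric]) (simp_all add: pos_ne)
    finally have 1: "ln (\<Prod>i\<in>{count_S n z..<Suc n}. pmf (bernoulli_pmf p) (fst z i)) = B (Suc n) - B (N n)" ..
    have 2: "ln (\<Prod>j<n. pmf (bernoulli_pmf (1 - p)) (digit j z)) = A n"
      unfolding A_def by (rule ln_prod) (simp_all add: pos_ne)
    have "(\<Prod>j<n. pmf (bernoulli_pmf (1 - p)) (digit j z)) > 0"
      "(\<Prod>i\<in>{count_S n z..<Suc n}. pmf (bernoulli_pmf p) (fst z i)) > 0"
      using p by (intro prod_pos ballI pos; simp)+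
    then show ?thesis
      unfolding 1[symmetric] 2[symmetric]
      using region_prob_pos[OF p, of "coding n z"] by (simp only: ln_mult_pos mult_pos_pos)
  qed
  have "(\<lambda>n. A n / real n + ln (region_prob p (coding n z)) / real n + (B (Suc n) / real n - B (N n) / real n))
      \<longlonglongrightarrow> - H p + 0 + (- H p - - (H p * L))"
    by (intro tendsto_intros A R BS BN)
  then show ?thesis
    unfolding eq by (simp add: add_divide_distrib diff_divide_distrib algebra_simps)
qed

text \<open>The measure of a ball is constant while r lies between consecutive powers of 1/\<beta>,
  so the limit over radii reduces to the limit along integers.\<close>

lemma has_local_dim_regular:
  assumes p: "0 < p" "p < 1" and reg: "regular p z"
    and L: "(\<lambda>k. M k z / real k) \<longlonglongrightarrow> L"
  shows "has_local_dim X \<rho> (\<nu> p) z (H p / ln \<beta> * (2 - L))"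
proof -
  have z: "z \<in> interior_points" using reg by (simp add: regular_def)
  have ln\<beta>: "ln \<beta> > 0" by simp
  define V where "V = (\<lambda>n. (\<Prod>j<n. pmf (bernoulli_pmf (1 - p)) (digit j z)) * region_prob p (coding n z)
    * (\<Prod>i\<in>{count_S n z..<Suc n}. pmf (bernoulli_pmf p) (fst z i)))"
  have "pmf (bernoulli_pmf q) b > 0" if "0 < q" "q < 1" for q b
    using that by (cases b) auto
  then have V_pos: "V n > 0" for n
    unfolding V_def using p region_prob_pos[OF p] by (intro mult_pos_pos prod_pos) auto
  \<comment> \<open>Chosen so that r is \<beta> to the power \<open>- x r\<close>; its floor is the
    n required by \<open>measure_mball\<close>.\<close>
  define x where "x = (\<lambda>r. - ln r / ln \<beta>)"
  define n where "n = (\<lambda>r. nat \<lfloor>x r\<rfloor>)"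
  have ball: "measure (\<nu> p) (Metric_space.mball X \<rho> z r) = V (n r)" if r: "0 < r" "r < 1" for r
  proof -
    have "x r \<ge> 0" using r by (simp add: x_def divide_nonpos_pos)
    then have n: "real (n r) \<le> x r" "x r < real (Suc (n r))"
      unfolding n_def by linarith+
    have pow: "(1 / \<beta>) ^ k = exp (- (real k * ln \<beta>))" for k
      by (simp add: exp_minus exp_of_nat_mult power_inverse divide_inverse)
    have "r = exp (- (x r * ln \<beta>))" using r ln\<beta> by (simp add: x_def)
    moreover have "exp (- (x r * ln \<beta>)) \<le> (1 / \<beta>) ^ n r" "(1 / \<beta>) ^ Suc (n r) < exp (- (x r * ln \<beta>))"
      unfolding pow using n ln\<beta> by simp_all
    ultimately show ?thesis
      unfolding V_def using r by (intro measure_mball[OF p z]) simp_all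
  qed
  have ev: "\<forall>\<^sub>F r :: real in at_right 0. 0 < r \<and> r < 1"
    by (simp add: eventually_at_right_field) (meson zero_less_one)
  have x_top: "filterlim x at_top (at_right 0)"
    unfolding x_def divide_inverse using ln\<beta>
    by (intro filterlim_at_top_mult_tendsto_pos[OF tendsto_const]
      filterlim_compose[OF filterlim_uminus_at_top_at_bot ln_at_0]) simp
  have n_top: "filterlim n sequentially (at_right 0)"
    unfolding n_def
    by (intro filterlim_compose[OF filterlim_nat_sequentially]
      filterlim_compose[OF filterlim_floor_sequentially] x_top)
  have "((\<lambda>y::real. real (nat \<lfloor>y\<rfloor>) / y) \<longlongrightarrow> 1) at_top"
  proof (rule tendsto_sandwich)
    show "\<forall>\<^sub>F y::real in at_top. 1 - 1 / y \<le> real (nat \<lfloor>y\<rfloor>) / y"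
      using eventually_ge_at_top[of 1]
    proof eventually_elim
      case (elim y)
      have "(y - 1) / y \<le> real (nat \<lfloor>y\<rfloor>) / y"
        using elim by (intro divide_right_mono) linarith+
      then show ?case using elim by (simp add: diff_divide_distrib)
    qed
    show "\<forall>\<^sub>F y::real in at_top. real (nat \<lfloor>y\<rfloor>) / y \<le> 1"
      using eventually_ge_at_top[of 1] by eventually_elim (simp add: field_simps)
    have "((\<lambda>y::real. 1 - inverse y) \<longlongrightarrow> 1 - 0) at_top"
      by (intro tendsto_intros tendsto_inverse_0_at_top filterlim_ident)
    then show "((\<lambda>y::real. 1 - 1 / y) \<longlongrightarrow> 1) at_top"
      by (simp add: inverse_eq_divide)
  qed simp
  from filterlim_compose[OF this x_top]
  have nx: "((\<lambda>r. real (n r) / x r) \<longlongrightarrow> 1) (at_right 0)"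
    by (simp add: n_def)
  have "(\<lambda>n. ln (V n) / real n) \<longlonglongrightarrow> - H p * (2 - L)"
    unfolding V_def by (rule cylinder_measure_exponent[OF p reg L])
  from filterlim_compose[OF this n_top] nx
  have "((\<lambda>r. ln (V (n r)) / real (n r) * (real (n r) / x r) * (- 1 / ln \<beta>)) \<longlongrightarrow>
      - H p * (2 - L) * 1 * (- 1 / ln \<beta>)) (at_right 0)"
    by (intro tendsto_intros)
  \<comment> \<open>The cancellation of \<open>n r\<close> needs \<open>n r\<close> to be at least
    1, which holds for small r by \<open>n_top\<close>.\<close>
  moreover have "\<forall>\<^sub>F r in at_right 0. ln (V (n r)) / real (n r) * (real (n r) / x r) * (- 1 / ln \<beta>) =
      ln (measure (\<nu> p) (Metric_space.mball X \<rho> z r)) / ln r"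
    using ev n_top[unfolded filterlim_at_top, rule_format, of 1]
  proof eventually_elim
    case (elim r)
    then have "x r * ln \<beta> = - ln r" using ln\<beta> by (simp add: x_def)
    then have "x r = - ln r / ln \<beta>" by (simp add: x_def)
    then show ?case using elim ball[of r] ln\<beta> by simp
  qed
  moreover have "- H p * (2 - L) * 1 * (- 1 / ln \<beta>) = H p / ln \<beta> * (2 - L)"
    by simp
  ultimately have "((\<lambda>r. ln (measure (\<nu> p) (Metric_space.mball X \<rho> z r)) / ln r) \<longlongrightarrow>
      H p / ln \<beta> * (2 - L)) (at_right 0)"
    by (simp only: tendsto_cong)
  moreover have "\<forall>\<^sub>F r in at_right 0. measure (\<nu> p) (Metric_space.mball X \<rho> z r) > 0"
    using ev by eventually_elim (simp add: ball V_pos)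
  ultimately show ?thesis
    by (simp add: has_local_dim_def)
qed

theorem theorem5p2:
  fixes p :: real
  assumes "0 < p" and "p < 1"
  shows "AE z in \<nu> p. convergent (\<lambda>k. M k z / real k) \<longrightarrow>
           has_local_dim X \<rho> (\<nu> p) z (H p / ln \<beta> * (2 - lim (\<lambda>k. M k z / real k)))"
  using AE_regular[OF assms]
proof eventually_elim
  case (elim z)
  then show ?case
    using has_local_dim_regular[OF assms] by (auto simp: convergent_LIMSEQ_iff)
qed

end
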